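(* Each of the surfaces $M=\mathbb{R}^2$ and $M=\mathbb{T}^2$ (the torus) admits two continuous flows $\Phi_1$ and $\Phi_2$ whose sets of singular points are discrete, which have equivalent separatrix configurations (in the sense of Markus and Neumann), but which are not topologically equivalent.
   Context: A flow $(M,\Phi)$ is a continuous flow $\Phi:\mathbb{R}\times M\to M$ on a surface $M$, and $\Phi_p(t)=\Phi(t,p)$. The orbit of $p$ is $\varphi(p)=\{\Phi_p(t):t\in\mathbb{R}\}$. A point $p$ is singular if $\varphi(p)=\{p\}$. $\alpha(p)=\{u\in M:\exists t_n\to-\infty,\ \Phi_p(t_n)\to u\}$, and $\omega(p)$ is defined likewise with $t_n\to+\infty$; $\alpha'(p)=\alpha(p)\setminus\varphi(p)$ and $\omega'(p)=\omega(p)\setminus\varphi(p)$. A region is an open connected set; a set is invariant if it is a union of orbits. A discrete set is a set consisting of isolated points. $\mathrm{Bd}$ denotes the topological boundary in $M$. Two flows are topologically equivalent if there is a homeomorphism between the underlying spaces carrying orbits onto orbits and preserving time directions (the same terminology is used for restrictions to invariant sets). An invariant region $\Omega$ is parallel if the restriction $(\Omega,\Phi)$ is topologically equivalent to one of: the flow of the vector field $(1,0)$ on $\mathbb{R}^2$ (strip); the flow of $(-y,x)$ on $\mathbb{R}^2\setminus\{0\}$ (annular); the flow of $(-x,-y)$ on $\mathbb{R}^2\setminus\{0\}$ (radial); the flow induced by $(1,0)$ on $\mathbb{T}^2=\mathbb{R}^2/\mathbb{Z}^2$ (toral). An orbit $\varphi(p)$ is ordinary if it is contained in a parallel region $\Omega$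 such that: (i) $\alpha'(q)=\alpha'(p)$ and $\omega'(q)=\omega'(p)$ for every $q\in\Omega$; (ii) $\mathrm{Bd}\,\Omega$ is the union of $\alpha'(p)$, $\omega'(p)$ and exactly two orbits $\varphi(a)$ and $\varphi(b)$ with $\alpha'(a)=\alpha'(b)=\alpha'(p)$ and $\omega'(a)=\omega'(b)=\omega'(p)$ (where $\varphi(a)$ and $\varphi(b)$ are distinct and disjoint from $\alpha'(p)$ and $\omega'(p)$; $\alpha'(p)$ and $\omega'(p)$ may be empty and may intersect). An orbit that is not ordinary is a separatrix. The union $\mathcal{S}$ of all separatrices is a closed set; the components of $M\setminus\mathcal{S}$ are the canonical regions. A separatrix configuration $\mathcal{S}^+$ of $(M,\Phi)$ is the union of $\mathcal{S}$ together with one representative orbit from each canonical region. Separatrix configurations $\mathcal{S}_1^+$ of $(M,\Phi_1)$ and $\mathcal{S}_2^+$ of $(M,\Phi_2)$ are equivalent if there is a homeomorphism of $M$ onto $M$ carrying the orbits of $\Phi_1$ in $\mathcal{S}_1^+$ onto the orbits of $\Phi_2$ in $\mathcal{S}_2^+$ and preserving time directions. *)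

theory Defs
  imports "HOL-Analysis.Analysis"
begin

section \<open>Flows, orbits and limit sets\<close>

definition is_flow :: "'a topology \<Rightarrow> (real \<Rightarrow> 'a \<Rightarrow> 'a) \<Rightarrow> bool" where
  "is_flow M \<Phi> \<longleftrightarrow>
     continuous_map (prod_topology euclideanreal M) M (\<lambda>(t, p). \<Phi> t p) \<and>
     (\<forall>p\<in>topspace M. \<Phi> 0 p = p) \<and>
     (\<forall>p\<in>topspace M. \<forall>s t. \<Phi> (s + t) p = \<Phi> s (\<Phi> t p))"

definition orbit :: "(real \<Rightarrow> 'a \<Rightarrow> 'a) \<Rightarrow> 'a \<Rightarrow> 'a set" where
  "orbit \<Phi> p = range (\<lambda>t. \<Phi> t p)"

definition invariant_set :: "'a topology \<Rightarrow> (real \<Rightarrow> 'a \<Rightarrow> 'a) \<Rightarrow> 'a set \<Rightarrow> bool" where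
  "invariant_set M \<Phi> A \<longleftrightarrow> (\<exists>P\<subseteq>topspace M. A = \<Union>(orbit \<Phi> ` P))"

definition singular_points :: "'a topology \<Rightarrow> (real \<Rightarrow> 'a \<Rightarrow> 'a) \<Rightarrow> 'a set" where
  "singular_points M \<Phi> = {p \<in> topspace M. orbit \<Phi> p = {p}}"

text \<open>A discrete set need not be closed: its points only have to be isolated in the set.\<close>

definition discrete_set :: "'a topology \<Rightarrow> 'a set \<Rightarrow> bool" where
  "discrete_set M A \<longleftrightarrow> A \<subseteq> topspace M \<and> (\<forall>p\<in>A. \<exists>U. openin M U \<and> U \<inter> A = {p})"

definition alpha_limit :: "'a topology \<Rightarrow> (real \<Rightarrow> 'a \<Rightarrow> 'a) \<Rightarrow> 'a \<Rightarrow> 'a set" where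
  "alpha_limit M \<Phi> p = {u. \<exists>\<tau> :: nat \<Rightarrow> real. filterlim \<tau> at_bot sequentially \<and>
                             limitin M (\<lambda>n. \<Phi> (\<tau> n) p) u sequentially}"

definition omega_limit :: "'a topology \<Rightarrow> (real \<Rightarrow> 'a \<Rightarrow> 'a) \<Rightarrow> 'a \<Rightarrow> 'a set" where
  "omega_limit M \<Phi> p = {u. \<exists>\<tau> :: nat \<Rightarrow> real. filterlim \<tau> at_top sequentially \<and>
                             limitin M (\<lambda>n. \<Phi> (\<tau> n) p) u sequentially}"

definition alpha' :: "'a topology \<Rightarrow> (real \<Rightarrow> 'a \<Rightarrow> 'a) \<Rightarrow> 'a \<Rightarrow> 'a set" where
  "alpha' M \<Phi> p = alpha_limit M \<Phi> p - orbit \<Phi> p"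

definition omega' :: "'a topology \<Rightarrow> (real \<Rightarrow> 'a \<Rightarrow> 'a) \<Rightarrow> 'a \<Rightarrow> 'a set" where
  "omega' M \<Phi> p = omega_limit M \<Phi> p - orbit \<Phi> p"


section \<open>Topological equivalence\<close>

text \<open>
  \<open>h\<close> carries the \<open>\<Phi>\<close>-orbits in \<open>A\<close> onto the \<open>\<Psi>\<close>-orbits in \<open>B\<close>, preserving time directions.
  Preservation of time is expressed by an increasing reparametrization of the whole time axis (an
  increasing surjection of the reals is a homeomorphism); on a periodic orbit this is the lift of
  an orientation preserving homeomorphism between circles.
\<close>

definition carries_orbits ::
    "('a \<Rightarrow> 'b) \<Rightarrow> (real \<Rightarrow> 'a \<Rightarrow> 'a) \<Rightarrow> 'a set \<Rightarrow> (real \<Rightarrow> 'b \<Rightarrow> 'b) \<Rightarrow> 'b set \<Rightarrow> bool" where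
  "carries_orbits h \<Phi> A \<Psi> B \<longleftrightarrow>
     (\<lambda>\<O>. h ` \<O>) ` (orbit \<Phi> ` A) = orbit \<Psi> ` B \<and>
     (\<forall>p\<in>A. \<exists>\<sigma> :: real \<Rightarrow> real. strict_mono \<sigma> \<and> surj \<sigma> \<and> (\<forall>t. h (\<Phi> t p) = \<Psi> (\<sigma> t) (h p)))"

text \<open>For the restriction of a flow to an invariant set \<open>\<Omega>\<close>, take \<open>subtopology M \<Omega>\<close> for \<open>M\<close>.\<close>

definition topologically_equivalent ::
    "'a topology \<Rightarrow> (real \<Rightarrow> 'a \<Rightarrow> 'a) \<Rightarrow> 'b topology \<Rightarrow> (real \<Rightarrow> 'b \<Rightarrow> 'b) \<Rightarrow> bool" where
  "topologically_equivalent M \<Phi> N \<Psi> \<longleftrightarrow>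
     (\<exists>h. homeomorphic_map M N h \<and> carries_orbits h \<Phi> (topspace M) \<Psi> (topspace N))"


section \<open>The plane and the torus\<close>

abbreviation plane :: "(real \<times> real) topology" where
  "plane \<equiv> euclidean"

text \<open>
  The torus is the quotient of the plane by the integer lattice: its points are the cosets of the
  lattice, and it carries the quotient topology.
\<close>

definition torus_proj :: "real \<times> real \<Rightarrow> (real \<times> real) set" where
  "torus_proj x = {y. fst y - fst x \<in> \<int> \<and> snd y - snd x \<in> \<int>}"

definition torus :: "(real \<times> real) set topology" where
  "torus = topology (\<lambda>U. U \<subseteq> range torus_proj \<and> open (torus_proj -` U))"

lemma openin_torus: "openin torus U \<longleftrightarrow> U \<subseteq> range torus_proj \<and> open (torus_proj -` U)"
proof -
  have "istopology (\<lambda>U. U \<subseteq> range torus_proj \<and> open (torus_proj -` U))"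
    unfolding istopology_def by (auto simp: vimage_Union)
  then show ?thesis
    by (simp add: torus_def topology_inverse')
qed

lemma topspace_torus: "topspace torus = range torus_proj"
proof
  show "topspace torus \<subseteq> range torus_proj"
    using openin_topspace[of torus] unfolding openin_torus by (rule conjunct1)
  have "torus_proj -` range torus_proj = UNIV"
    by blast
  then have "openin torus (range torus_proj)"
    unfolding openin_torus by simp
  then show "range torus_proj \<subseteq> topspace torus"
    by (rule openin_subset)
qed

lemma quotient_map_torus_proj: "quotient_map plane torus torus_proj"
  by (auto simp: quotient_map_def topspace_torus openin_torus vimage_def)


section \<open>Parallel regions\<close>

definition strip_flow :: "real \<Rightarrow> real \<times> real \<Rightarrow> real \<times> real" where
  "strip_flow t = (\<lambda>(x, y). (x + t, y))"

definition annular_flow :: "real \<Rightarrow> real \<times> real \<Rightarrow> real \<times> real" where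
  "annular_flow t = (\<lambda>(x, y). (x * cos t - y * sin t, x * sin t + y * cos t))"

definition radial_flow :: "real \<Rightarrow> real \<times> real \<Rightarrow> real \<times> real" where
  "radial_flow t = (\<lambda>(x, y). (x * exp (- t), y * exp (- t)))"

definition toral_flow :: "real \<Rightarrow> (real \<times> real) set \<Rightarrow> (real \<times> real) set" where
  "toral_flow t X = strip_flow t ` X"

lemma strip_flow_vector_field:
  "strip_flow 0 p = p"
  "((\<lambda>t. strip_flow t p) has_vector_derivative (1, 0)) (at t)"
proof -
  show "strip_flow 0 p = p"
    by (simp add: strip_flow_def split_beta)
  show "((\<lambda>t. strip_flow t p) has_vector_derivative (1, 0)) (at t)"
    unfolding strip_flow_def split_beta fst_conv snd_conv
    by (intro has_vector_derivative_Pair; unfold has_real_derivative_iff_has_vector_derivative[symmetric])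
       (auto intro!: derivative_eq_intros)
qed

lemma annular_flow_vector_field:
  "annular_flow 0 p = p"
  "((\<lambda>t. annular_flow t p) has_vector_derivative
      (- snd (annular_flow t p), fst (annular_flow t p))) (at t)"
proof -
  show "annular_flow 0 p = p"
    by (simp add: annular_flow_def split_beta)
  show "((\<lambda>t. annular_flow t p) has_vector_derivative
      (- snd (annular_flow t p), fst (annular_flow t p))) (at t)"
    unfolding annular_flow_def split_beta fst_conv snd_conv
    by (intro has_vector_derivative_Pair; unfold has_real_derivative_iff_has_vector_derivative[symmetric])
       (auto intro!: derivative_eq_intros)
qed

lemma radial_flow_vector_field:
  "radial_flow 0 p = p"
  "((\<lambda>t. radial_flow t p) has_vector_derivative
      (- fst (radial_flow t p), - snd (radial_flow t p))) (at t)"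
proof -
  show "radial_flow 0 p = p"
    by (simp add: radial_flow_def split_beta)
  show "((\<lambda>t. radial_flow t p) has_vector_derivative
      (- fst (radial_flow t p), - snd (radial_flow t p))) (at t)"
    unfolding radial_flow_def split_beta fst_conv snd_conv
    by (intro has_vector_derivative_Pair; unfold has_real_derivative_iff_has_vector_derivative[symmetric])
       (auto intro!: derivative_eq_intros)
qed

lemma toral_flow_torus_proj: "toral_flow t (torus_proj x) = torus_proj (strip_flow t x)"
proof (intro set_eqI iffI)
  fix y assume "y \<in> toral_flow t (torus_proj x)"
  then obtain z where "z \<in> torus_proj x" "y = strip_flow t z"
    unfolding toral_flow_def by blast
  then show "y \<in> torus_proj (strip_flow t x)"
    by (simp add: torus_proj_def strip_flow_def split_beta)
next
  fix y assume "y \<in> torus_proj (strip_flow t x)"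
  then have "(fst y - t, snd y) \<in> torus_proj x"
    by (simp add: torus_proj_def strip_flow_def split_beta diff_diff_eq add.commute)
  moreover have "y = strip_flow t (fst y - t, snd y)"
    by (simp add: strip_flow_def)
  ultimately show "y \<in> toral_flow t (torus_proj x)"
    unfolding toral_flow_def by (rule rev_image_eqI)
qed

definition parallel_region :: "'a topology \<Rightarrow> (real \<Rightarrow> 'a \<Rightarrow> 'a) \<Rightarrow> 'a set \<Rightarrow> bool" where
  "parallel_region M \<Phi> \<Omega> \<longleftrightarrow>
     openin M \<Omega> \<and> connectedin M \<Omega> \<and> invariant_set M \<Phi> \<Omega> \<and>
     (topologically_equivalent (subtopology M \<Omega>) \<Phi> plane strip_flow \<or>
      topologically_equivalent (subtopology M \<Omega>) \<Phi> (subtopology plane (- {0})) annular_flow \<or>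
      topologically_equivalent (subtopology M \<Omega>) \<Phi> (subtopology plane (- {0})) radial_flow \<or>
      topologically_equivalent (subtopology M \<Omega>) \<Phi> torus toral_flow)"


section \<open>Separatrices and separatrix configurations\<close>

text \<open>The orbit of \<open>p\<close> is ordinary.\<close>

definition ordinary :: "'a topology \<Rightarrow> (real \<Rightarrow> 'a \<Rightarrow> 'a) \<Rightarrow> 'a \<Rightarrow> bool" where
  "ordinary M \<Phi> p \<longleftrightarrow>
     (\<exists>\<Omega>. parallel_region M \<Phi> \<Omega> \<and> orbit \<Phi> p \<subseteq> \<Omega> \<and>
        (\<forall>q\<in>\<Omega>. alpha' M \<Phi> q = alpha' M \<Phi> p \<and> omega' M \<Phi> q = omega' M \<Phi> p) \<and>
        (\<exists>a\<in>topspace M. \<exists>b\<in>topspace M.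
           M frontier_of \<Omega> = alpha' M \<Phi> p \<union> omega' M \<Phi> p \<union> orbit \<Phi> a \<union> orbit \<Phi> b \<and>
           orbit \<Phi> a \<noteq> orbit \<Phi> b \<and>
           (orbit \<Phi> a \<union> orbit \<Phi> b) \<inter> (alpha' M \<Phi> p \<union> omega' M \<Phi> p) = {} \<and>
           alpha' M \<Phi> a = alpha' M \<Phi> p \<and> alpha' M \<Phi> b = alpha' M \<Phi> p \<and>
           omega' M \<Phi> a = omega' M \<Phi> p \<and> omega' M \<Phi> b = omega' M \<Phi> p))"

definition separatrix_set :: "'a topology \<Rightarrow> (real \<Rightarrow> 'a \<Rightarrow> 'a) \<Rightarrow> 'a set" where
  "separatrix_set M \<Phi> = {p \<in> topspace M. \<not> ordinary M \<Phi> p}"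

definition canonical_regions :: "'a topology \<Rightarrow> (real \<Rightarrow> 'a \<Rightarrow> 'a) \<Rightarrow> 'a set set" where
  "canonical_regions M \<Phi> =
     connected_components_of (subtopology M (topspace M - separatrix_set M \<Phi>))"

definition separatrix_configuration ::
    "'a topology \<Rightarrow> (real \<Rightarrow> 'a \<Rightarrow> 'a) \<Rightarrow> 'a set \<Rightarrow> bool" where
  "separatrix_configuration M \<Phi> S \<longleftrightarrow>
     (\<exists>r. (\<forall>C\<in>canonical_regions M \<Phi>. r C \<in> C) \<and>
          S = separatrix_set M \<Phi> \<union> (\<Union>C\<in>canonical_regions M \<Phi>. orbit \<Phi> (r C)))"

definition equivalent_configurations ::
    "'a topology \<Rightarrow> (real \<Rightarrow> 'a \<Rightarrow> 'a) \<Rightarrow> 'a set \<Rightarrow> (real \<Rightarrow> 'a \<Rightarrow> 'a) \<Rightarrow> 'a set \<Rightarrow> bool" where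
  "equivalent_configurations M \<Phi>\<^sub>1 S\<^sub>1 \<Phi>\<^sub>2 S\<^sub>2 \<longleftrightarrow>
     (\<exists>h. homeomorphic_map M M h \<and> carries_orbits h \<Phi>\<^sub>1 S\<^sub>1 \<Phi>\<^sub>2 S\<^sub>2)"

text \<open>
  A flow has one separatrix configuration for each choice of representatives in the canonical
  regions; equivalence is asked for some choice.
\<close>

definition have_equivalent_configurations ::
    "'a topology \<Rightarrow> (real \<Rightarrow> 'a \<Rightarrow> 'a) \<Rightarrow> (real \<Rightarrow> 'a \<Rightarrow> 'a) \<Rightarrow> bool" where
  "have_equivalent_configurations M \<Phi>\<^sub>1 \<Phi>\<^sub>2 \<longleftrightarrow>
     (\<exists>S\<^sub>1 S\<^sub>2. separatrix_configuration M \<Phi>\<^sub>1 S\<^sub>1 \<and> separatrix_configuration M \<Phi>\<^sub>2 S\<^sub>2 \<and>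
              equivalent_configurations M \<Phi>\<^sub>1 S\<^sub>1 \<Phi>\<^sub>2 S\<^sub>2)"

end

(*
  On the plane, with c = x - y, compare the diagonal translation G with a flow F that agrees with G
  for |c| >= 1, reverses the line c = 0 and has a Reeb strip on each of 0 < c < 1 and -1 < c < 0,
  whose orbits accumulate at both boundary lines.  The lines c = 0, c = 1, c = -1 cannot be separated
  in the orbit space of F.  Nevertheless every line lies in a strip whose boundary consists of exactly
  two orbits: a strip around c = 1 that contains a whole Reeb strip has c = 0 in its boundary, and
  nothing requires the two boundary orbits to lie at different ends of the strip.  So all orbits are
  ordinary for both flows and a single line c = 1 is a separatrix configuration of both.

  On the torus, viewed as the square of the circle R u {oo}, both flows extend by translation to the
  circles y = oo and x = oo, fixing (oo, oo), which is then both the alpha- and the omega-limit set of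
  every other orbit.  Again only the fixed point is a separatrix.  But the extension of G has just two
  non-separated orbits besides the fixed point (the circles at infinity), and that of F has more.
*)
theory Submission
  imports Defs "HOL-Real_Asymp.Real_Asymp"
begin

section \<open>Flows given by charts\<close>

text \<open>Every region below is the image of an explicit chart that conjugates the unit
  translation with the flow, time included, so the reversing flow has to be solvable in elementary
  functions. Logistic growth of w = 1 - |c| with speed 1 - 2 * w along the lines achieves this: the
  speed is 1 at w = 0, where the translation takes over continuously, and -1 at w = 1, the reversed
  line. The difficult chart is the one around c = 1: it has to straighten a Reeb strip and the
  translated part together, and on the torus also the circle at infinity beyond them. The coordinate
  k = 1 / c makes these one piece: the Reeb strip is k > 1, where k - 1 grows exponentially in time,
  the translated part is 0 < k \<le> 1, and infinity is k = 0. The same chart then serves the plane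
  with k > 0 and the torus with all real k. Equivalences preserve non-separation of orbits. In the
  plane one non-separated pair of distinct orbits decides. On the torus the translation has such a
  pair too, so three orbits and a pigeonhole argument are used.\<close>

declare split_paired_All [simp del] split_paired_Ex [simp del]

text \<open>A strip region with its parametrization, in exact time. Exactness lets it serve two
  ends: its range is a parallel region, and the group law and continuity of the flow can be read off
  in it.\<close>

definition flow_chart :: "'a topology \<Rightarrow> (real \<Rightarrow> 'a \<Rightarrow> 'a) \<Rightarrow> (real \<times> real \<Rightarrow> 'a) \<Rightarrow> bool" where
  "flow_chart M \<Phi> e \<longleftrightarrow>
     continuous_map plane M e \<and> open_map plane M e \<and> inj e \<and> (\<forall>t z. \<Phi> t (e z) = e (strip_flow t z))"

lemma strip_flow_zero: "strip_flow 0 z = z"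
  by (simp add: strip_flow_def split_beta)

lemma strip_flow_add: "strip_flow (s + t) z = strip_flow s (strip_flow t z)"
  by (simp add: strip_flow_def split_beta)

lemma continuous_on_strip_flow: "continuous_on UNIV (\<lambda>(t, z). strip_flow t z)"
  unfolding strip_flow_def split_beta by (intro continuous_intros)

lemma flow_chart_mem: "flow_chart M \<Phi> e \<Longrightarrow> e z \<in> topspace M"
  by (auto simp: flow_chart_def continuous_map_def)

lemma flow_chart_open: "flow_chart M \<Phi> e \<Longrightarrow> open U \<Longrightarrow> openin M (e ` U)"
  by (auto simp: flow_chart_def open_map_def)

lemma flow_chart_flow: "flow_chart M \<Phi> e \<Longrightarrow> \<Phi> t (e z) = e (strip_flow t z)"
  by (auto simp: flow_chart_def)

text \<open>The inverse of the chart is the equivalence with the strip flow; since time is kept, the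
  identity is the reparametrization.\<close>

lemma parallel_region_flow_chart:
  assumes e: "flow_chart M \<Phi> e"
  shows "parallel_region M \<Phi> (range e)"
proof -
  have cont: "continuous_map plane M e" and op: "open_map plane M e" and inj: "inj e"
    and fl: "\<And>t z. \<Phi> t (e z) = e (strip_flow t z)"
    using e by (auto simp: flow_chart_def)
  have sub: "range e \<subseteq> topspace M"
    using flow_chart_mem[OF e] by auto
  have "homeomorphic_map plane (subtopology M (range e)) e"
  proof (rule bijective_open_imp_homeomorphic_map)
    show "continuous_map plane (subtopology M (range e)) e"
      using cont by (simp add: continuous_map_in_subtopology)
    show "open_map plane (subtopology M (range e)) e"
      using op by (simp add: open_map_into_subtopology)
    show "e ` topspace plane = topspace (subtopology M (range e))"
      using sub by auto
    show "inj_on e (topspace plane)"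
      using inj by simp
  qed
  then obtain g where g: "homeomorphic_maps plane (subtopology M (range e)) e g"
    using homeomorphic_map_maps by blast
  then have hg: "homeomorphic_map (subtopology M (range e)) plane g"
    using homeomorphic_maps_map by blast
  have ge: "g (e z) = z" for z
    using g by (simp add: homeomorphic_maps_def)
  have gfl: "g (\<Phi> t q) = strip_flow t (g q)" if "q \<in> range e" for t q
    using that by (auto simp: fl ge simp del: split_paired_all)
  have top: "topspace (subtopology M (range e)) = range e"
    using sub by auto
  have orb: "g ` orbit \<Phi> q = orbit strip_flow (g q)" if "q \<in> range e" for q
    using gfl[OF that] by (auto simp: orbit_def image_iff)
  have "carries_orbits g \<Phi> (range e) strip_flow UNIV"
    unfolding carries_orbits_def
  proof (intro conjI ballI)
    have "(\<lambda>\<O>. g ` \<O>) ` orbit \<Phi> ` range e = (\<lambda>q. orbit strip_flow (g q)) ` range e"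
      unfolding image_image by (intro image_cong refl orb rangeI)
    also have "\<dots> = range (orbit strip_flow)"
      by (simp add: image_image ge)
    finally show "(\<lambda>\<O>. g ` \<O>) ` orbit \<Phi> ` range e = range (orbit strip_flow)" .
    show "\<exists>\<sigma>::real \<Rightarrow> real. strict_mono \<sigma> \<and> surj \<sigma> \<and> (\<forall>t. g (\<Phi> t q) = strip_flow (\<sigma> t) (g q))"
      if "q \<in> range e" for q
      using gfl[OF that] by (intro exI[of _ "\<lambda>t. t"]) (auto simp: strict_mono_def)
  qed
  then have "topologically_equivalent (subtopology M (range e)) \<Phi> plane strip_flow"
    using hg top by (auto simp: topologically_equivalent_def)
  moreover have "openin M (range e)"
    using flow_chart_open[OF e open_UNIV] .
  moreover have "connectedin M (range e)"
    using connectedin_continuous_map_image[OF cont, of UNIV] connected_UNIV by simp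
  moreover have "invariant_set M \<Phi> (range e)"
    unfolding invariant_set_def
  proof (intro exI[of _ "range e"] conjI sub)
    show "range e = \<Union> (orbit \<Phi> ` range e)"
    proof
      show "range e \<subseteq> \<Union> (orbit \<Phi> ` range e)"
      proof
        fix q assume q: "q \<in> range e"
        then have "q \<in> orbit \<Phi> q"
          using fl[of 0] unfolding orbit_def by (auto simp: strip_flow_zero intro: range_eqI[of _ _ 0])
        then show "q \<in> \<Union> (orbit \<Phi> ` range e)"
          using q by blast
      qed
    qed (auto simp: orbit_def fl)
  qed
  ultimately show ?thesis
    by (simp add: parallel_region_def)
qed

text \<open>One set \<open>K\<close> stands for all limit sets: it is empty in the plane and the
  fixed point on the torus, for \<alpha>' and \<omega>' alike.\<close>

lemma ordinary_flow_chart: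
  assumes e: "flow_chart M \<Phi> e" and q: "q \<in> range e"
    and ab: "a \<in> topspace M" "b \<in> topspace M" "orbit \<Phi> a \<noteq> orbit \<Phi> b"
    and lim: "\<And>u. u \<in> range e \<union> {a, b} \<Longrightarrow> alpha' M \<Phi> u = K \<and> omega' M \<Phi> u = K"
    and fr: "M frontier_of range e = K \<union> orbit \<Phi> a \<union> orbit \<Phi> b"
    and dis: "(orbit \<Phi> a \<union> orbit \<Phi> b) \<inter> K = {}"
  shows "ordinary M \<Phi> q"
  unfolding ordinary_def
proof (rule exI[of _ "range e"], intro conjI)
  show "parallel_region M \<Phi> (range e)"
    by (rule parallel_region_flow_chart[OF e])
  show "orbit \<Phi> q \<subseteq> range e"
    using q by (auto simp: orbit_def flow_chart_flow[OF e])
  show "\<forall>u\<in>range e. alpha' M \<Phi> u = alpha' M \<Phi> q \<and> omega' M \<Phi> u = omega' M \<Phi> q"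
    using lim q by simp
  have q_lim: "alpha' M \<Phi> q = K" "omega' M \<Phi> q = K"
    using lim q by auto
  show "\<exists>a\<in>topspace M. \<exists>b\<in>topspace M.
           M frontier_of range e = alpha' M \<Phi> q \<union> omega' M \<Phi> q \<union> orbit \<Phi> a \<union> orbit \<Phi> b \<and>
           orbit \<Phi> a \<noteq> orbit \<Phi> b \<and>
           (orbit \<Phi> a \<union> orbit \<Phi> b) \<inter> (alpha' M \<Phi> q \<union> omega' M \<Phi> q) = {} \<and>
           alpha' M \<Phi> a = alpha' M \<Phi> q \<and> alpha' M \<Phi> b = alpha' M \<Phi> q \<and>
           omega' M \<Phi> a = omega' M \<Phi> q \<and> omega' M \<Phi> b = omega' M \<Phi> q"
    unfolding q_lim
  proof (rule bexI[OF _ ab(1)], rule bexI[OF _ ab(2)])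
  qed (use lim[of a] lim[of b] ab(3) fr dis in simp)
qed

text \<open>If the rest of the space is open, the closure of \<Omega> cannot leave \<Omega> \<union>
  B. Frontiers are computed below by exhibiting that rest as an open, possibly empty, set.\<close>

lemma frontier_of_eqI:
  assumes "openin M \<Omega>" "\<Omega> \<inter> B = {}" "openin M (topspace M - (\<Omega> \<union> B))" "B \<subseteq> M closure_of \<Omega>"
  shows "M frontier_of \<Omega> = B"
proof -
  have "M closure_of \<Omega> \<inter> (topspace M - (\<Omega> \<union> B)) = {}"
    using assms(3) by (subst Int_commute, subst openin_Int_closure_of_eq_empty) auto
  moreover have "M closure_of \<Omega> \<subseteq> topspace M"
    by (rule closure_of_subset_topspace)
  ultimately show ?thesis
    using assms by (auto simp: frontier_of_openin)
qed

lemma limitin_imp_in_closure_of: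
  assumes "limitin M f l F" "F \<noteq> bot" "\<And>x. f x \<in> S" "S \<subseteq> topspace M"
  shows "l \<in> M closure_of S"
proof (rule limitin_closedin[OF assms(1) closedin_closure_of _ assms(2)])
  show "\<forall>\<^sub>F x in F. f x \<in> M closure_of S"
    using assms(3) closure_of_subset[OF assms(4)] by (auto intro!: always_eventually)
qed

lemma continuous_map_in_closure_of:
  assumes "continuous_map plane M e" "e ` A \<subseteq> S" "z \<in> closure A"
  shows "e z \<in> M closure_of S"
proof -
  have "e z \<in> M closure_of (e ` A)"
    using continuous_map_image_closure_subset[OF assms(1), of A] assms(3) by auto
  then show ?thesis
    using closure_of_mono[OF assms(2)] by blast
qed

text \<open>In the chart the flow is the jointly continuous translation, and the chart is open, so a
  product box around (t, z) is carried to a neighbourhood of (t, q).\<close>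

lemma topcontinuous_at_flow_chart:
  assumes e: "flow_chart M \<Phi> e" and q: "q \<in> range e"
    and cl: "\<And>t u. u \<in> topspace M \<Longrightarrow> \<Phi> t u \<in> topspace M"
  shows "topcontinuous_at (prod_topology euclideanreal M) M (\<lambda>(t, p). \<Phi> t p) (t, q)"
  unfolding topcontinuous_at_def
proof (intro conjI allI impI ballI)
  obtain z where z: "q = e z"
    using q by auto
  have inj: "inj e"
    using e by (simp add: flow_chart_def)
  have cont: "continuous_map euclidean M (\<lambda>(t, z). e (strip_flow t z))" 
  proof -
    have "continuous_map euclidean plane (\<lambda>(t, z). strip_flow t z)"
      using continuous_on_strip_flow by simp
    moreover have "continuous_map plane M e"
      using e by (simp add: flow_chart_def)
    ultimately have "continuous_map euclidean M (e \<circ> (\<lambda>(t, z). strip_flow t z))"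
      by (rule continuous_map_compose)
    then show ?thesis
      by (simp add: o_def case_prod_unfold)
  qed
  show "(t, q) \<in> topspace (prod_topology euclideanreal M)"
    using flow_chart_mem[OF e] z by simp
  show "(\<lambda>(t, p). \<Phi> t p) \<in> topspace (prod_topology euclideanreal M) \<rightarrow> topspace M"
    using cl by auto
  fix V assume V: "openin M V \<and> (case (t, q) of (t, p) \<Rightarrow> \<Phi> t p) \<in> V"
  define W where "W = {x. (\<lambda>(t, z). e (strip_flow t z)) x \<in> V}"
  have "open W"
    using openin_continuous_map_preimage[OF cont, of V] V by (simp add: W_def)
  moreover have "(t, z) \<in> W"
    using V z by (simp add: W_def flow_chart_flow[OF e])
  ultimately obtain A B where AB: "open A" "open B" "t \<in> A" "z \<in> B" "A \<times> B \<subseteq> W"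
    by (metis open_prod_elim mem_Sigma_iff)
  have "openin (prod_topology euclideanreal M) (A \<times> e ` B)"
    using AB flow_chart_open[OF e] by (simp add: openin_prod_Times_iff)
  moreover have "(case x of (t, p) \<Rightarrow> \<Phi> t p) \<in> V" if "x \<in> A \<times> e ` B" for x
    using that AB(5) by (auto simp: W_def flow_chart_flow[OF e])
  ultimately show "\<exists>U. openin (prod_topology euclideanreal M) U \<and> (t, q) \<in> U \<and> (\<forall>y\<in>U. (case y of (t, p) \<Rightarrow> \<Phi> t p) \<in> V)"
    using AB z by (intro exI[of _ "A \<times> e ` B"]) auto
qed

lemma flow_law_flow_chart:
  assumes e: "flow_chart M \<Phi> e" and q: "q \<in> range e"
  shows "\<Phi> 0 q = q" "\<Phi> (s + t) q = \<Phi> s (\<Phi> t q)" "\<Phi> t q \<in> range e"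
  using q by (auto simp: flow_chart_flow[OF e] strip_flow_zero strip_flow_add)

text \<open>The group law and joint continuity are checked point by point, and a chart contains the
  whole orbit of each of its points.\<close>

lemma is_flow_of_charts:
  assumes "\<And>q. q \<in> topspace M \<Longrightarrow> \<exists>e. flow_chart M \<Phi> e \<and> q \<in> range e"
  shows "is_flow M \<Phi>"
proof -
  have cl: "\<Phi> t u \<in> topspace M" if u: "u \<in> topspace M" for t u
    using assms[OF u] flow_law_flow_chart flow_chart_mem by (metis imageE)
  have "continuous_map (prod_topology euclideanreal M) M (\<lambda>(t, p). \<Phi> t p)"
    unfolding continuous_map_eq_topcontinuous_at
    using assms cl topcontinuous_at_flow_chart by fastforce
  moreover have "\<Phi> 0 q = q" "\<Phi> (s + t) q = \<Phi> s (\<Phi> t q)" if q: "q \<in> topspace M" for q s t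
    using assms[OF q] flow_law_flow_chart by metis+
  ultimately show ?thesis
    unfolding is_flow_def by blast
qed

lemma topcontinuous_at_subtopology:
  assumes "topcontinuous_at X Y f x" "x \<in> S"
  shows "topcontinuous_at (subtopology X S) Y f x"
  unfolding topcontinuous_at_def
proof (intro conjI ballI allI impI)
  fix V assume "openin Y V \<and> f x \<in> V"
  then obtain U where "openin X U" "x \<in> U" "\<forall>y\<in>U. f y \<in> V"
    using assms(1) unfolding topcontinuous_at_def by meson
  then show "\<exists>U. openin (subtopology X S) U \<and> x \<in> U \<and> (\<forall>y\<in>U. f y \<in> V)"
    using assms(2) by (intro exI[of _ "U \<inter> S"]) (auto intro: openin_subtopology_Int)
qed (use assms in \<open>auto simp: topcontinuous_at_def\<close>)

text \<open>
  A flow on a punctured compact surface extends to the puncture: complements of compact sets are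
  mapped to complements of compact sets, locally uniformly in time.
\<close>

lemma is_flow_of_charts_fixed_point:
  assumes H: "Hausdorff_space M" and C: "compact_space M" and p: "p \<in> topspace M"
    and fix_p: "\<And>t. \<Phi> t p = p"
    and ch: "\<And>q. q \<in> topspace M - {p} \<Longrightarrow> \<exists>e. flow_chart M \<Phi> e \<and> q \<in> range e \<and> p \<notin> range e"
  shows "is_flow M \<Phi>"
proof -
  have cl: "\<Phi> t u \<in> topspace M" if u: "u \<in> topspace M" for t u
  proof (cases "u = p")
    case False
    then obtain e where "flow_chart M \<Phi> e" "u \<in> range e"
      using ch[of u] u by auto
    then show ?thesis
      using flow_law_flow_chart(3)[of M \<Phi> e u t] flow_chart_mem[of M \<Phi> e] by auto
  qed (simp add: fix_p p)
  have ne: "\<Phi> t u \<noteq> p" if "u \<in> topspace M - {p}" for t u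
    using ch[OF that] flow_law_flow_chart(3) by metis
  have law: "\<Phi> 0 q = q" "\<Phi> (s + t) q = \<Phi> s (\<Phi> t q)" if q: "q \<in> topspace M" for q s t
  proof -
    have "\<Phi> 0 q = q \<and> \<Phi> (s + t) q = \<Phi> s (\<Phi> t q)"
    proof (cases "q = p")
      case False
      then obtain e where "flow_chart M \<Phi> e" "q \<in> range e"
        using ch[of q] q by auto
      then show ?thesis
        using flow_law_flow_chart by metis
    qed (simp add: fix_p)
    then show "\<Phi> 0 q = q" "\<Phi> (s + t) q = \<Phi> s (\<Phi> t q)"
      by auto
  qed
  have away: "topcontinuous_at (prod_topology euclideanreal M) M (\<lambda>(t, p). \<Phi> t p) (t, q)"
    if "q \<in> topspace M - {p}" for t q
    using ch[OF that] topcontinuous_at_flow_chart cl by metis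
  have contY: "continuous_map (subtopology (prod_topology euclideanreal M) (UNIV \<times> (topspace M - {p}))) M
                 (\<lambda>(t, p). \<Phi> t p)"
    unfolding continuous_map_eq_topcontinuous_at
  proof
    fix x assume "x \<in> topspace (subtopology (prod_topology euclideanreal M) (UNIV \<times> (topspace M - {p})))"
    then obtain t q where x: "x = (t, q)" "q \<in> topspace M - {p}"
      by auto
    show "topcontinuous_at (subtopology (prod_topology euclideanreal M) (UNIV \<times> (topspace M - {p}))) M
                 (\<lambda>(t, p). \<Phi> t p) x"
      using away[OF x(2), of t] x by (auto intro!: topcontinuous_at_subtopology)
  qed
  have at_p: "topcontinuous_at (prod_topology euclideanreal M) M (\<lambda>(t, p). \<Phi> t p) (t, p)" for t
    unfolding topcontinuous_at_def
  proof (intro conjI allI impI ballI)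
    fix V assume V: "openin M V \<and> (case (t, p) of (t, p) \<Rightarrow> \<Phi> t p) \<in> V"
    define K where "K = topspace M - V"
    \<comment> \<open>Flowing \<open>K\<close> back over the negated time window collects all points
      that are outside \<open>V\<close> at some time within 1 of \<open>t\<close>. This set is
      compact, hence closed, and misses \<open>p\<close>, since no other orbit reaches
      \<open>p\<close>.\<close>
    define L where "L = (\<lambda>(s, q). \<Phi> s q) ` ({- t - 1..- t + 1} \<times> K)"
    have KY: "K \<subseteq> topspace M - {p}"
      using V fix_p by (auto simp: K_def)
    have "compactin M K"
      using C V by (auto simp: K_def intro: closedin_compact_space)
    then have "compactin (prod_topology euclideanreal M) ({- t - 1..- t + 1} \<times> K)"
      by (simp add: compactin_Times)
    then have "compactin (subtopology (prod_topology euclideanreal M) (UNIV \<times> (topspace M - {p})))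
                 ({- t - 1..- t + 1} \<times> K)"
      using KY by (auto simp: compactin_subtopology)
    then have "compactin M L"
      unfolding L_def using contY by (rule image_compactin)
    with H have "closedin M L"
      by (rule compactin_imp_closedin)
    moreover have "p \<notin> L"
      using ne KY by (fastforce simp: L_def)
    ultimately have op: "openin (prod_topology euclideanreal M) ({t - 1<..<t + 1} \<times> (topspace M - L))"
      by (simp add: openin_prod_Times_iff openin_diff)
    have "\<Phi> s q \<in> V" if s: "s \<in> {t - 1<..<t + 1}" and q: "q \<in> topspace M - L" for s q
    proof (rule ccontr)
      assume "\<Phi> s q \<notin> V"
      then have "\<Phi> s q \<in> K"
        using cl q by (simp add: K_def)
      then have "\<Phi> (- s) (\<Phi> s q) \<in> L"
        using s by (force simp: L_def)
      then show False
        using law(2)[of q "- s" s] law(1)[of q] q by simp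
    qed
    then show "\<exists>U. openin (prod_topology euclideanreal M) U \<and> (t, p) \<in> U \<and> (\<forall>y\<in>U. (case y of (t, p) \<Rightarrow> \<Phi> t p) \<in> V)"
      using op p \<open>p \<notin> L\<close> by (intro exI[of _ "{t - 1<..<t + 1} \<times> (topspace M - L)"]) auto
  qed (use p cl in auto)
  have "continuous_map (prod_topology euclideanreal M) M (\<lambda>(t, p). \<Phi> t p)"
    unfolding continuous_map_eq_topcontinuous_at
  proof
    fix x assume "x \<in> topspace (prod_topology euclideanreal M)"
    then show "topcontinuous_at (prod_topology euclideanreal M) M (\<lambda>(t, p). \<Phi> t p) x"
      using away at_p by (cases x, cases "snd x = p") auto
  qed
  then show ?thesis
    unfolding is_flow_def using law by blast
qed

section \<open>Limit sets of orbits that converge to a point\<close>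

lemma omega_limit_eq_singleton:
  assumes "Hausdorff_space M" and lim: "limitin M (\<lambda>t. \<Phi> t q) p at_top"
  shows "omega_limit M \<Phi> q = {p}"
proof
  show "omega_limit M \<Phi> q \<subseteq> {p}"
  proof
    fix u assume "u \<in> omega_limit M \<Phi> q"
    then obtain \<tau> :: "nat \<Rightarrow> real" where \<tau>: "filterlim \<tau> at_top sequentially"
        and u: "limitin M (\<lambda>n. \<Phi> (\<tau> n) q) u sequentially"
      by (auto simp: omega_limit_def)
    have "limitin M (\<lambda>n. \<Phi> (\<tau> n) q) p sequentially"
      using lim eventually_compose_filterlim[OF _ \<tau>] by (auto simp: limitin_def)
    then show "u \<in> {p}"
      using limitin_Hausdorff_unique[OF u _ _ assms(1)] by auto
  qed
  have "limitin M (\<lambda>n. \<Phi> (real n) q) p sequentially"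
    using lim eventually_compose_filterlim[OF _ filterlim_real_sequentially] by (auto simp: limitin_def)
  then show "{p} \<subseteq> omega_limit M \<Phi> q"
    using filterlim_real_sequentially by (auto simp: omega_limit_def)
qed

lemma alpha_limit_conv_omega_limit: "alpha_limit M \<Phi> q = omega_limit M (\<lambda>t. \<Phi> (- t)) q"
proof (intro set_eqI iffI)
  fix u assume "u \<in> alpha_limit M \<Phi> q"
  then obtain \<tau> :: "nat \<Rightarrow> real" where "filterlim \<tau> at_bot sequentially" "limitin M (\<lambda>n. \<Phi> (\<tau> n) q) u sequentially"
    by (auto simp: alpha_limit_def)
  then show "u \<in> omega_limit M (\<lambda>t. \<Phi> (- t)) q"
    unfolding omega_limit_def by (auto simp: filterlim_uminus_at_bot intro!: exI[of _ "\<lambda>n. - \<tau> n"])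
next
  fix u assume "u \<in> omega_limit M (\<lambda>t. \<Phi> (- t)) q"
  then obtain \<tau> :: "nat \<Rightarrow> real" where "filterlim \<tau> at_top sequentially" "limitin M (\<lambda>n. \<Phi> (- \<tau> n) q) u sequentially"
    by (auto simp: omega_limit_def)
  then show "u \<in> alpha_limit M \<Phi> q"
    unfolding alpha_limit_def by (auto simp: filterlim_uminus_at_bot intro!: exI[of _ "\<lambda>n. - \<tau> n"])
qed

lemma alpha_limit_eq_singleton:
  assumes "Hausdorff_space M" and lim: "limitin M (\<lambda>t. \<Phi> t q) p at_bot"
  shows "alpha_limit M \<Phi> q = {p}"
proof -
  have "limitin M (\<lambda>t. \<Phi> (- t) q) p at_top"
    using lim by (auto simp: limitin_def at_bot_mirror eventually_filtermap)
  then show ?thesis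
    using omega_limit_eq_singleton[OF assms(1), of "\<lambda>t. \<Phi> (- t)"] by (simp add: alpha_limit_conv_omega_limit)
qed

text \<open>A regular orbit tends to \<open>p\<close>, so it enters every neighbourhood of
  \<open>p\<close>, and its points have \<omega>' = {p}. The point \<open>p\<close> itself has empty
  \<omega>', because its own orbit is removed. Thus \<omega>' is not constant on any region around
  \<open>p\<close>.\<close>

lemma not_ordinary_fixed_point:
  assumes H: "Hausdorff_space M" and p: "p \<in> topspace M" and fix_p: "\<And>t. \<Phi> t p = p"
    and ne: "\<And>t q. q \<in> topspace M - {p} \<Longrightarrow> \<Phi> t q \<in> topspace M - {p}"
    and om: "\<And>q. q \<in> topspace M - {p} \<Longrightarrow> limitin M (\<lambda>t. \<Phi> t q) p at_top"
    and q: "q \<in> topspace M - {p}"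
  shows "\<not> ordinary M \<Phi> p"
proof
  assume "ordinary M \<Phi> p"
  then obtain \<Omega> where \<Omega>: "openin M \<Omega>" "orbit \<Phi> p \<subseteq> \<Omega>" "\<And>u. u \<in> \<Omega> \<Longrightarrow> omega' M \<Phi> u = omega' M \<Phi> p"
    unfolding ordinary_def parallel_region_def by meson
  have "p \<in> \<Omega>"
    using \<Omega>(2) fix_p by (auto simp: orbit_def)
  then have "\<forall>\<^sub>F t in at_top. \<Phi> t q \<in> \<Omega>"
    using om[OF q] \<Omega>(1) by (auto simp: limitin_def)
  then obtain t where t: "\<Phi> t q \<in> \<Omega>"
    using eventually_happens' trivial_limit_at_top_linorder by blast
  have u: "\<Phi> t q \<in> topspace M - {p}"
    using ne q by blast
  then have "p \<in> omega' M \<Phi> (\<Phi> t q)"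
    using omega_limit_eq_singleton[of M \<Phi>, OF H om[OF u]] ne[OF u] by (auto simp: omega'_def orbit_def)
  moreover have "limitin M (\<lambda>t. \<Phi> t p) p at_top"
    using p by (simp add: fix_p)
  then have "omega' M \<Phi> p = {}"
    using omega_limit_eq_singleton[of M \<Phi> p p, OF H] by (simp add: omega'_def orbit_def fix_p)
  ultimately show False
    using \<Omega>(3)[OF t] by auto
qed

text \<open>A connected complement of \<open>Z\<close> is the only canonical region of either flow,
  so both can be given the same representative orbit. As the flows agree on it and on
  \<open>Z\<close>, the identity is an equivalence.\<close>

lemma have_equivalent_configurations_of_common_orbit:
  assumes S: "separatrix_set M \<Phi> = Z" "separatrix_set M \<Psi> = Z"
    and conn: "connectedin M (topspace M - Z)" and r: "r \<in> topspace M - Z"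
    and same: "\<And>q t. q \<in> Z \<union> orbit \<Phi> r \<Longrightarrow> \<Phi> t q = \<Psi> t q" and r0: "\<Phi> 0 r = r"
  shows "have_equivalent_configurations M \<Phi> \<Psi>"
proof -
  have can: "canonical_regions M X = {topspace M - Z}" if "separatrix_set M X = Z" for X
  proof -
    have "subtopology M (topspace M - Z) \<noteq> trivial_topology"
      using r by (metis Diff_subset empty_iff topspace_discrete_topology topspace_subtopology_subset)
    then show ?thesis
      using conn that unfolding canonical_regions_def
      by (auto simp: connected_components_of_eq_singleton connectedin_def)
  qed
  have rr: "r \<in> orbit \<Phi> r"
    using r0 by (metis orbit_def rangeI)
  have orb: "orbit \<Psi> q = orbit \<Phi> q" if "q \<in> Z \<union> orbit \<Phi> r" for q
    using same[OF that] by (simp add: orbit_def)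
  define A where "A = Z \<union> orbit \<Phi> r"
  have "separatrix_configuration M \<Phi> A" "separatrix_configuration M \<Psi> A"
    unfolding separatrix_configuration_def can[OF S(1)] can[OF S(2)] S A_def
    using r rr orb[of r] by (auto intro!: exI[of _ "\<lambda>_. r"])
  moreover have "equivalent_configurations M \<Phi> A \<Psi> A"
    unfolding equivalent_configurations_def carries_orbits_def
  proof (rule exI[of _ id], intro conjI ballI)
    have "(\<lambda>\<O>. id ` \<O>) ` orbit \<Phi> ` A = orbit \<Phi> ` A"
      by simp
    also have "\<dots> = orbit \<Psi> ` A"
      using orb by (auto simp: A_def)
    finally show "(\<lambda>\<O>. id ` \<O>) ` orbit \<Phi> ` A = orbit \<Psi> ` A" .
    show "\<exists>\<sigma>::real \<Rightarrow> real. strict_mono \<sigma> \<and> surj \<sigma> \<and> (\<forall>t. id (\<Phi> t p) = \<Psi> (\<sigma> t) (id p))" if "p \<in> A" for p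
      using same that by (intro exI[of _ "\<lambda>t. t"]) (auto simp: strict_mono_def A_def)
  qed simp
  ultimately show ?thesis
    unfolding have_equivalent_configurations_def by blast
qed

section \<open>Non-separated orbits as an invariant of equivalence\<close>

text \<open>For a flow this says that the orbits of \<open>z\<close> and \<open>w\<close> have no
  disjoint neighbourhoods in the orbit space. The time \<open>t\<close> may have either sign, so
  that only orbits enter.\<close>

definition prolongs :: "'a topology \<Rightarrow> (real \<Rightarrow> 'a \<Rightarrow> 'a) \<Rightarrow> 'a \<Rightarrow> 'a \<Rightarrow> bool" where
  "prolongs M \<Phi> z w \<longleftrightarrow>
     (\<forall>U V. openin M U \<and> z \<in> U \<and> openin M V \<and> w \<in> V \<longrightarrow> (\<exists>q\<in>U. \<exists>t. \<Phi> t q \<in> V))"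

lemma prolongs_of_sequences:
  assumes "limitin M f z sequentially" "limitin M (\<lambda>n. \<Phi> (\<tau> n) (f n)) w sequentially"
  shows "prolongs M \<Phi> z w"
  unfolding prolongs_def
proof (intro allI impI)
  fix U V assume UV: "openin M U \<and> z \<in> U \<and> openin M V \<and> w \<in> V"
  then have "\<forall>\<^sub>F n in sequentially. f n \<in> U \<and> \<Phi> (\<tau> n) (f n) \<in> V"
    using assms by (auto simp: limitin_def intro: eventually_conj)
  then obtain n where "f n \<in> U \<and> \<Phi> (\<tau> n) (f n) \<in> V"
    using eventually_happens' sequentially_bot by blast
  then show "\<exists>q\<in>U. \<exists>t. \<Phi> t q \<in> V"
    by blast
qed

lemma carries_orbits_reparametrization:
  assumes "carries_orbits h \<Phi> A \<Psi> B" "q \<in> A"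
  shows "\<exists>\<sigma> :: real \<Rightarrow> real. surj \<sigma> \<and> (\<forall>t. h (\<Phi> t q) = \<Psi> (\<sigma> t) (h q))"
proof -
  have "\<forall>p\<in>A. \<exists>\<sigma> :: real \<Rightarrow> real. strict_mono \<sigma> \<and> surj \<sigma> \<and> (\<forall>t. h (\<Phi> t p) = \<Psi> (\<sigma> t) (h p))"
    using assms(1) unfolding carries_orbits_def by (rule conjunct2)
  then show ?thesis
    using assms(2) by meson
qed

text \<open>Neighbourhoods of the image points pull back by continuity. This is applied to
  equivalences and also to the inclusion of the plane into the torus.\<close>

lemma prolongs_continuous_map:
  assumes cont: "continuous_map M N h" and z: "z \<in> topspace M" "w \<in> topspace M"
    and orb: "\<And>q t. q \<in> topspace M \<Longrightarrow> \<exists>s. h (\<Phi> t q) = \<Psi> s (h q)"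
    and pr: "prolongs M \<Phi> z w"
  shows "prolongs N \<Psi> (h z) (h w)"
  unfolding prolongs_def
proof (intro allI impI)
  fix U V assume UV: "openin N U \<and> h z \<in> U \<and> openin N V \<and> h w \<in> V"
  have "openin M {x \<in> topspace M. h x \<in> U}" "openin M {x \<in> topspace M. h x \<in> V}"
    using UV openin_continuous_map_preimage[OF cont] by auto
  then have "\<exists>q\<in>{x \<in> topspace M. h x \<in> U}. \<exists>t. \<Phi> t q \<in> {x \<in> topspace M. h x \<in> V}"
    using pr[unfolded prolongs_def, rule_format, of "{x \<in> topspace M. h x \<in> U}" "{x \<in> topspace M. h x \<in> V}"]
      z UV by auto
  then obtain q t where q: "q \<in> topspace M" "h q \<in> U" "h (\<Phi> t q) \<in> V"
    by auto
  then show "\<exists>q\<in>U. \<exists>t. \<Psi> t q \<in> V"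
    using orb[OF q(1), of t] by metis
qed

lemma prolongs_homeomorphic_map:
  assumes h: "homeomorphic_map M N h" "carries_orbits h \<Phi> (topspace M) \<Psi> (topspace N)"
    and z: "z \<in> topspace M" "w \<in> topspace M" and pr: "prolongs M \<Phi> z w"
  shows "prolongs N \<Psi> (h z) (h w)"
  using homeomorphic_imp_continuous_map[OF h(1)] z _ pr
proof (rule prolongs_continuous_map)
  show "\<exists>s. h (\<Phi> t q) = \<Psi> s (h q)" if "q \<in> topspace M" for q t
    using carries_orbits_reparametrization[OF h(2) that] by metis
qed

text \<open>Surjectivity of the time change places \<open>h w\<close> at some time of the image of
  the orbit of \<open>z\<close>, and injectivity of \<open>h\<close> brings this back. Hence
  distinct orbits have distinct images.\<close>

lemma orbit_homeomorphic_map: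
  assumes h: "homeomorphic_map M N h" "carries_orbits h \<Phi> (topspace M) \<Psi> (topspace N)"
    and z: "z \<in> topspace M" "w \<in> topspace M" and cl: "\<And>t. \<Phi> t z \<in> topspace M"
    and orb: "h w \<in> orbit \<Psi> (h z)"
  shows "w \<in> orbit \<Phi> z"
proof -
  obtain s where s: "h w = \<Psi> s (h z)"
    using orb by (auto simp: orbit_def)
  obtain \<sigma> :: "real \<Rightarrow> real" where \<sigma>: "surj \<sigma>" "\<forall>t. h (\<Phi> t z) = \<Psi> (\<sigma> t) (h z)"
    using carries_orbits_reparametrization[OF h(2) z(1)] by metis
  then obtain t where "\<sigma> t = s"
    by (metis surjD)
  then have "h w = h (\<Phi> t z)"
    using \<sigma>(2) s by simp
  then have "w = \<Phi> t z"
    using h(1) z cl by (metis homeomorphic_map_def inj_on_eq_iff)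
  then show ?thesis
    by (auto simp: orbit_def)
qed

lemma not_prolongs:
  assumes "openin M U" "z \<in> U" "openin M V" "w \<in> V" "U \<inter> V = {}" "\<And>q t. q \<in> U \<Longrightarrow> \<Phi> t q \<in> U"
  shows "\<not> prolongs M \<Phi> z w"
  using assms unfolding prolongs_def by blast

text \<open>Openness of \<theta> comes from invariance of domain, so an explicit formula only has to
  be shown continuous and injective.\<close>

lemma flow_chart_compose:
  assumes "continuous_map plane M B" "open_map plane M B" "inj B"
    and "continuous_on UNIV \<theta>" "inj \<theta>"
    and "\<And>t z. \<Phi> t (B (\<theta> z)) = B (\<theta> (strip_flow t z))"
  shows "flow_chart M \<Phi> (B \<circ> \<theta>)"
  unfolding flow_chart_def
proof (intro conjI allI)
  show "continuous_map plane M (B \<circ> \<theta>)"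
    using assms by (intro continuous_map_compose[of _ plane]) auto
  have "open_map plane plane \<theta>"
    using invariance_of_domain[of _ \<theta>] assms(4,5)
    by (auto simp: open_map_def intro: continuous_on_subset inj_on_subset)
  then show "open_map plane M (B \<circ> \<theta>)"
    using assms(2) by (rule open_map_compose)
  show "inj (B \<circ> \<theta>)"
    using assms(3,5) by (rule inj_compose)
qed (use assms(6) in simp)

lemma flow_chart_plane:
  assumes "continuous_on UNIV e" "inj e" "\<And>t z. \<Phi> t (e z) = e (strip_flow t z)"
  shows "flow_chart plane \<Phi> e"
proof -
  have "open_map plane plane (\<lambda>z :: real \<times> real. z)"
    by (simp add: open_map_def)
  then show ?thesis
    using flow_chart_compose[of plane "\<lambda>z. z" e \<Phi>] assms by (simp add: o_def)
qed

section \<open>The plane flows\<close>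

text \<open>The plane in the coordinates \<open>s = (x + y) / 2\<close> and \<open>c = x - y\<close>.\<close>

definition sc :: "real \<Rightarrow> real \<Rightarrow> real \<times> real" where
  "sc s c = (s + c / 2, s - c / 2)"

definition diag_flow :: "real \<Rightarrow> real \<times> real \<Rightarrow> real \<times> real" where
  "diag_flow t = (\<lambda>(x, y). (x + t, y + t))"

text \<open>
  For \<open>\<bar>c\<bar> \<le> 1\<close> the flow below solves \<open>s' = 1 - 2 * w\<close> and the logistic equation \<open>w' = w * (1 - w)\<close> for
  \<open>w = 1 - \<bar>c\<bar>\<close>, so the orbits in \<open>0 < \<bar>c\<bar> < 1\<close> run from \<open>\<bar>c\<bar> = 1\<close> to the reversed line \<open>c = 0\<close>.
\<close>

definition damping :: "real \<Rightarrow> real \<Rightarrow> real" where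
  "damping t c = min 1 \<bar>c\<bar> + (1 - min 1 \<bar>c\<bar>) * exp t"

definition reeb_flow :: "real \<Rightarrow> real \<times> real \<Rightarrow> real \<times> real" where
  "reeb_flow t = (\<lambda>(x, y). sc ((x + y) / 2 + t - 2 * ln (damping t (x - y))) ((x - y) / damping t (x - y)))"

definition swap :: "real \<times> real \<Rightarrow> real \<times> real" where
  "swap = (\<lambda>(x, y). (y, x))"

lemma sc_cases: obtains s c where "z = sc s c"
proof -
  have "z = sc ((fst z + snd z) / 2) (fst z - snd z)"
    by (cases z) (simp add: sc_def field_simps)
  then show ?thesis
    by (rule that)
qed

lemma sc_eq_iff: "sc s c = sc s' c' \<longleftrightarrow> s = s' \<and> c = c'"
  by (auto simp: sc_def)

lemma fst_sc: "fst (sc s c) = s + c / 2" and snd_sc: "snd (sc s c) = s - c / 2"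
  by (auto simp: sc_def)

lemma diff_sc: "fst (sc s c) - snd (sc s c) = c"
  by (simp add: sc_def)

lemma continuous_on_sc [continuous_intros]:
  "continuous_on A f \<Longrightarrow> continuous_on A g \<Longrightarrow> continuous_on A (\<lambda>x. sc (f x) (g x))"
  unfolding sc_def by (intro continuous_intros) auto

lemma swap_swap: "swap (swap z) = z"
  by (simp add: swap_def split_beta)

lemma swap_sc: "swap (sc s c) = sc s (- c)"
  by (simp add: swap_def sc_def)

lemma diff_swap: "fst (swap z) - snd (swap z) = - (fst z - snd z)"
  by (simp add: swap_def split_beta)

lemma continuous_on_swap: "continuous_on A swap"
  unfolding swap_def split_beta by (intro continuous_intros)

lemma inj_swap: "inj swap"
  by (metis injI swap_swap)

lemma diag_flow_sc: "diag_flow t (sc s c) = sc (s + t) c"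
  by (simp add: sc_def diag_flow_def)

lemma reeb_flow_sc: "reeb_flow t (sc s c) = sc (s + t - 2 * ln (damping t c)) (c / damping t c)"
  by (simp add: reeb_flow_def sc_def)

lemma damping_pos: "damping t c > 0"
proof (cases "min 1 \<bar>c\<bar> > 0")
  case True
  then show ?thesis
    unfolding damping_def by (intro add_pos_nonneg) auto
next
  case False
  then have "c = 0" by auto
  then show ?thesis by (simp add: damping_def)
qed

lemma damping_outer: "\<bar>c\<bar> \<ge> 1 \<Longrightarrow> damping t c = 1"
  by (simp add: damping_def)

lemma damping_0: "damping t 0 = exp t"
  by (simp add: damping_def)

lemma damping_uminus: "damping t (- c) = damping t c"
  by (simp add: damping_def)

text \<open>The damping depends only on |c|, so the reflection in the diagonal commutes with the
  flow. Charts for c > 0 thereby yield those for c < 0.\<close>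

lemma reeb_flow_swap: "reeb_flow t (swap z) = swap (reeb_flow t z)"
  by (rule sc_cases[of z]) (simp add: swap_sc reeb_flow_sc damping_uminus)

lemma reeb_flow_outer: "\<bar>fst z - snd z\<bar> \<ge> 1 \<Longrightarrow> reeb_flow t z = diag_flow t z"
  by (rule sc_cases[of z]) (simp add: diff_sc reeb_flow_sc diag_flow_sc damping_outer)

lemma orbit_diag_flow: "orbit diag_flow z = {w. fst w - snd w = fst z - snd z}"
proof (rule sc_cases[of z])
  fix s c assume z: "z = sc s c"
  have "w \<in> orbit diag_flow z" if "fst w - snd w = c" for w
  proof (rule sc_cases[of w])
    fix s' c' assume w: "w = sc s' c'"
    then have "w = diag_flow (s' - s) z"
      using that z by (simp add: diff_sc diag_flow_sc)
    then show ?thesis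
      unfolding orbit_def by blast
  qed
  then show ?thesis
    using z by (auto simp: orbit_def diag_flow_sc diff_sc)
qed

text \<open>These orbits are full lines; they serve as edges of strips and as non-separated
  orbits.\<close>

lemma orbit_reeb_flow:
  assumes "fst z = snd z \<or> \<bar>fst z - snd z\<bar> \<ge> 1"
  shows "orbit reeb_flow z = {w. fst w - snd w = fst z - snd z}"
proof (cases "\<bar>fst z - snd z\<bar> \<ge> 1")
  case True
  then have "orbit reeb_flow z = orbit diag_flow z"
    by (simp add: orbit_def reeb_flow_outer)
  then show ?thesis
    by (simp add: orbit_diag_flow)
next
  case False
  with assms have z0: "fst z - snd z = 0" by auto
  show ?thesis
  proof (rule sc_cases[of z])
    fix s c assume z: "z = sc s c"
    then have c: "c = 0"
      using z0 by (simp add: diff_sc)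
    \<comment> \<open>The damping is exp t here, so s + t - 2 * ln (exp t) = s - t: the line is
      reversed.\<close>
    have *: "reeb_flow t z = sc (s - t) 0" for t
      using z c by (simp add: reeb_flow_sc damping_0)
    have "w \<in> orbit reeb_flow z" if "fst w - snd w = 0" for w
    proof (rule sc_cases[of w])
      fix s' c' assume w: "w = sc s' c'"
      then have "w = reeb_flow (s - s') z"
        using that * by (simp add: diff_sc)
      then show ?thesis
        unfolding orbit_def by blast
    qed
    then show ?thesis
      unfolding z0 by (auto simp: orbit_def * fst_sc snd_sc)
  qed
qed

section \<open>The chart of the reversing band |c| < 1\<close>

text \<open>Obtained from two functions on |c| < 1, with w = 1 - |c|: along the flow 2 * ln w - s
  grows at unit speed, which gives the time T, and c * exp T / w is constant, which gives the label
  J. Solving for s and c yields the formula. J = 0 is the reversed line, so both Reeb strips and the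
  line between them form one strip.\<close>

definition core_chart :: "real \<times> real \<Rightarrow> real \<times> real" where
  "core_chart = (\<lambda>(T, J). sc (T - 2 * ln (\<bar>J\<bar> + exp T)) (J / (\<bar>J\<bar> + exp T)))"

lemma core_denom_pos: "\<bar>J\<bar> + exp T > 0" for J T :: real
  by (simp add: add_nonneg_pos)

lemma continuous_on_core_chart: "continuous_on UNIV core_chart"
  unfolding core_chart_def split_beta
  by (intro continuous_intros) (use core_denom_pos in \<open>auto simp: order_less_imp_not_eq2\<close>)

lemma core_chart_inverse:
  fixes c s :: real
  assumes "\<bar>c\<bar> < 1"
  defines "T \<equiv> 2 * ln (1 - \<bar>c\<bar>) - s"
  shows "core_chart (T, c * exp T / (1 - \<bar>c\<bar>)) = sc s c"
proof -
  have p: "1 - \<bar>c\<bar> > 0" using assms by simp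
  have d: "\<bar>c * exp T / (1 - \<bar>c\<bar>)\<bar> + exp T = exp T / (1 - \<bar>c\<bar>)"
    using p by (simp add: abs_mult field_simps)
  have "ln (exp T / (1 - \<bar>c\<bar>)) = T - ln (1 - \<bar>c\<bar>)"
    using p by (simp add: ln_div)
  then have "core_chart (T, c * exp T / (1 - \<bar>c\<bar>)) = sc (T - 2 * (T - ln (1 - \<bar>c\<bar>))) c"
    unfolding core_chart_def split_conv d using p by (simp add: sc_eq_iff)
  then show ?thesis
    by (simp add: T_def)
qed

lemma core_chart_diff: "\<bar>J / (\<bar>J\<bar> + exp T)\<bar> < 1" "1 - \<bar>J / (\<bar>J\<bar> + exp T)\<bar> = exp T / (\<bar>J\<bar> + exp T)"
  for J T :: real
  using core_denom_pos[of J T] by (auto simp: abs_divide field_simps)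

lemma inj_core_chart: "inj core_chart"
proof (rule injI)
  fix z w assume eq: "core_chart z = core_chart w"
  obtain T J T' J' where zw: "z = (T, J)" "w = (T', J')"
    by (cases z, cases w)
  let ?c = "J / (\<bar>J\<bar> + exp T)" and ?c' = "J' / (\<bar>J'\<bar> + exp T')"
  have e: "T - 2 * ln (\<bar>J\<bar> + exp T) = T' - 2 * ln (\<bar>J'\<bar> + exp T')" "?c = ?c'"
    using eq by (auto simp: core_chart_def zw sc_eq_iff)
  have pp: "\<bar>J\<bar> + exp T > 0" "\<bar>J'\<bar> + exp T' > 0"
    using core_denom_pos by auto
  \<comment> \<open>The second coordinates determine T minus one logarithm, the first ones T minus
    twice that logarithm; together they give T and the logarithm.\<close>
  have "exp T / (\<bar>J\<bar> + exp T) = exp T' / (\<bar>J'\<bar> + exp T')"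
    using e(2) core_chart_diff(2) by metis
  then have "T - ln (\<bar>J\<bar> + exp T) = T' - ln (\<bar>J'\<bar> + exp T')"
    using pp by (metis exp_gt_zero ln_div ln_exp less_imp_neq)
  then have "T = T'" "ln (\<bar>J\<bar> + exp T) = ln (\<bar>J'\<bar> + exp T')"
    using e(1) by auto
  then have "\<bar>J\<bar> + exp T = \<bar>J'\<bar> + exp T'"
    using pp by simp
  then have "J = J'"
    using e(2) pp by (simp add: field_simps)
  then show "z = w"
    using zw \<open>T = T'\<close> by simp
qed

lemma flow_chart_core: "flow_chart plane reeb_flow core_chart"
proof (rule flow_chart_plane[OF continuous_on_core_chart inj_core_chart])
  fix t and z :: "real \<times> real"
  obtain T J where z: "z = (T, J)" by (cases z)
  define A where "A = \<bar>J\<bar> + exp T"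
  have A: "A > 0" using core_denom_pos by (simp add: A_def)
  define B where "B = \<bar>J\<bar> + exp (T + t)"
  have B: "B > 0" using core_denom_pos by (simp add: B_def)
  have c: "\<bar>J / A\<bar> < 1" "1 - \<bar>J / A\<bar> = exp T / A"
    using core_chart_diff by (auto simp: A_def)
  \<comment> \<open>The damping is the quotient of the denominators of the chart at the times T + t
    and T, so the one at T cancels from both coordinates.\<close>
  have "damping t (J / A) = \<bar>J\<bar> / A + (exp T / A) * exp t"
    using c A by (simp add: damping_def)
  also have "\<dots> = B / A"
    by (simp add: B_def exp_add add_divide_distrib)
  finally have D: "damping t (J / A) = B / A" .
  have "reeb_flow t (core_chart z) = sc (T - 2 * ln A + t - 2 * ln (B / A)) (J / A / (B / A))"
    by (simp add: z core_chart_def reeb_flow_sc D flip: A_def)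
  also have "\<dots> = sc (T + t - 2 * ln B) (J / B)"
    using A B by (simp add: ln_div sc_eq_iff)
  also have "\<dots> = core_chart (strip_flow t z)"
    by (simp add: z core_chart_def strip_flow_def B_def)
  finally show "reeb_flow t (core_chart z) = core_chart (strip_flow t z)" .
qed

lemma range_core_chart: "range core_chart = {z. \<bar>fst z - snd z\<bar> < 1}"
proof
  show "range core_chart \<subseteq> {z. \<bar>fst z - snd z\<bar> < 1}"
    using core_chart_diff by (auto simp: core_chart_def diff_sc)
  show "{z. \<bar>fst z - snd z\<bar> < 1} \<subseteq> range core_chart"
  proof
    fix z :: "real \<times> real" assume z: "z \<in> {z. \<bar>fst z - snd z\<bar> < 1}"
    show "z \<in> range core_chart"
    proof (rule sc_cases[of z])
      fix s c assume sc: "z = sc s c"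
      with z have "\<bar>c\<bar> < 1"
        by (simp add: diff_sc)
      then show ?thesis
        unfolding sc using core_chart_inverse[of c s] by (metis rangeI)
    qed
  qed
qed

section \<open>A chart across the lines |c| = 1\<close>

text \<open>The retraction onto [-1, 1]. In k = 1 / c this is the range where k is constant in time,
  and \<open>k - clip k\<close> measures how far a point has entered the reversing band.\<close>

definition clip :: "real \<Rightarrow> real" where
  "clip x = max (- 1) (min 1 x)"

text \<open>
  In the coordinate \<open>k = 1 / c\<close> the flow fixes \<open>k\<close> where \<open>\<bar>k\<bar> \<le> 1\<close> and multiplies \<open>\<bar>k\<bar> - 1\<close> by \<open>exp t\<close>
  elsewhere; \<open>T\<close> is the time and \<open>J\<close> labels the orbits, continuously across \<open>k = 0\<close>.
\<close>

definition straighten :: "real \<times> real \<Rightarrow> real \<times> real" where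
  "straighten = (\<lambda>(T, J). let r = (J - clip J) * exp T in
     (T - r / (1 + \<bar>r\<bar>) / 2 - 2 * ln (1 + \<bar>r\<bar>), clip J * (1 + \<bar>r\<bar>)))"

text \<open>The clipped part of k equals that of J, so r can be read off from k alone; then the
  first coordinate gives T, and undoing the growth of r gives J.\<close>

definition unstraighten :: "real \<times> real \<Rightarrow> real \<times> real" where
  "unstraighten = (\<lambda>(x, k). let r = k - clip k; T = x + r / (1 + \<bar>r\<bar>) / 2 + 2 * ln (1 + \<bar>r\<bar>) in
     (T, clip k + r * exp (- T)))"

lemma clip_add: 
  assumes "\<bar>r\<bar> = 0 \<or> (k = 1 \<and> r > 0) \<or> (k = -1 \<and> r < 0)" "\<bar>k\<bar> \<le> 1"
  shows "clip (k + r) = k"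
  using assms by (auto simp: clip_def)

lemma clip_excess: 
  shows "\<bar>x - clip x\<bar> = 0 \<or> (clip x = 1 \<and> x - clip x > 0) \<or> (clip x = -1 \<and> x - clip x < 0)" "\<bar>clip x\<bar> \<le> 1"
  by (auto simp: clip_def)

text \<open>An excess over [-1, 1] sits at an end of the interval and points outwards, and a
  positive factor preserves this. As time only multiplies the excess, the clipped part is constant
  along orbits.\<close>

lemma clip_scale:
  assumes "e > 0" 
  shows "clip (clip x + (x - clip x) * e) = clip x"
proof (rule clip_add)
  show "\<bar>(x - clip x) * e\<bar> = 0 \<or> clip x = 1 \<and> 0 < (x - clip x) * e \<or> clip x = - 1 \<and> (x - clip x) * e < 0"
    using clip_excess(1)[of x] assms by (auto simp: mult_neg_pos)
qed (rule clip_excess)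

text \<open>A nonzero r forces \<open>clip J\<close> to be the sign of r, so \<open>clip J\<close>
  times |r| is r. The product form in the definition shows where the coordinate vanishes; the sum
  form here can be inverted.\<close>

lemma straighten_alt:
  "straighten (T, J) = (let r = (J - clip J) * exp T in (T - r / (1 + \<bar>r\<bar>) / 2 - 2 * ln (1 + \<bar>r\<bar>), clip J + r))"
proof -
  have "clip J * \<bar>J - clip J\<bar> = J - clip J"
    using clip_excess(1)[of J] by auto
  then have "clip J * \<bar>(J - clip J) * exp T\<bar> = (J - clip J) * exp T"
    by (simp add: abs_mult)
  then show ?thesis
    by (simp add: straighten_def Let_def distrib_left)
qed

lemma unstraighten_straighten: "unstraighten (straighten z) = z"
proof -
  obtain T J where z: "z = (T, J)" by (cases z)
  define r where "r = (J - clip J) * exp T"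
  have k: "clip (clip J + r) = clip J"
    using clip_scale by (simp add: r_def)
  have "unstraighten (straighten z) = (T, clip J + r * exp (- T))"
    unfolding z straighten_alt Let_def unstraighten_def r_def[symmetric] by (simp add: k)
  also have "r * exp (- T) = J - clip J"
    by (simp add: r_def exp_minus)
  finally show ?thesis
    by (simp add: z)
qed

lemma straighten_unstraighten: "straighten (unstraighten z) = z"
proof -
  obtain x k where z: "z = (x, k)" by (cases z)
  define r where "r = k - clip k"
  define T where "T = x + r / (1 + \<bar>r\<bar>) / 2 + 2 * ln (1 + \<bar>r\<bar>)"
  have J: "clip (clip k + r * exp (- T)) = clip k"
    using clip_scale by (simp add: r_def)
  have u: "unstraighten z = (T, clip k + r * exp (- T))"
    by (simp add: z unstraighten_def Let_def r_def T_def)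
  have *: "(clip k + r * exp (- T) - clip k) * exp T = r"
    by (simp add: exp_minus)
  have "straighten (T, clip k + r * exp (- T)) = (T - r / (1 + \<bar>r\<bar>) / 2 - 2 * ln (1 + \<bar>r\<bar>), clip k + r)"
    unfolding straighten_alt Let_def J * ..
  then show ?thesis
    unfolding u by (simp add: T_def r_def z)
qed

lemma continuous_on_clip [continuous_intros]:
  "continuous_on A f \<Longrightarrow> continuous_on A (\<lambda>x. clip (f x))"
  unfolding clip_def by (intro continuous_intros)

lemma continuous_on_straighten: "continuous_on UNIV straighten"
  unfolding straighten_def split_beta Let_def
  by (intro continuous_intros) (use abs_ge_zero in \<open>force simp: add_nonneg_eq_0_iff\<close>)+

lemma inj_straighten: "inj straighten"
  by (metis injI unstraighten_straighten)

lemma range_straighten: "range straighten = UNIV"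
  by (metis straighten_unstraighten surjI)

lemma snd_straighten_eq_0_iff: "snd (straighten (T, J)) = 0 \<longleftrightarrow> J = 0"
proof -
  have "1 + \<bar>r\<bar> \<noteq> 0" for r :: real
    by (simp add: add_nonneg_eq_0_iff)
  then show ?thesis
    by (auto simp: straighten_def Let_def clip_def)
qed

lemma straighten_inner: "\<bar>J\<bar> \<le> 1 \<Longrightarrow> straighten (T, J) = (T, J)"
  by (auto simp: straighten_def Let_def clip_def)

text \<open>The second coordinate is \<open>1 / (x - y)\<close>, so that \<open>y = \<infinity>\<close> becomes the value \<open>0\<close>.\<close>

definition slope_chart :: "real \<times> real \<Rightarrow> real \<times> real" where
  "slope_chart = (\<lambda>(x, k). (x, x - 1 / k))"

lemma slope_chart_sc: "slope_chart (x, k) = sc (x - 1 / k / 2) (1 / k)"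
  by (simp add: slope_chart_def sc_def)

text \<open>This accounts for the term r / (1 + |r|) / 2 in \<open>straighten\<close>: the first
  coordinate there is x = s + c / 2, and the term is the change of c / 2 from its value
  \<open>1 / clip J / 2\<close> at zero excess. In s it cancels.\<close>

lemma slope_straighten:
  fixes J T :: real
  assumes "J \<noteq> 0"
  defines "E \<equiv> \<bar>J - clip J\<bar> * exp T"
  shows "slope_chart (straighten (T, J)) = sc (T - 1 / clip J / 2 - 2 * ln (1 + E)) (1 / (clip J * (1 + E)))"
proof -
  have k0: "clip J \<noteq> 0" using assms by (auto simp: clip_def)
  define r where "r = (J - clip J) * exp T"
  have rE: "\<bar>r\<bar> = E" by (simp add: r_def E_def abs_mult)
  have E0: "E \<ge> 0" by (simp add: E_def)
  have gen: "T - a / 2 - l - b / 2 = T - d / 2 - l" if "a + b = d" for a b d l :: real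
    using that by auto
  have h: "E / (1 + E) + 1 / (1 + E) = 1"
    using E0 by (simp flip: add_divide_distrib)
  have "r / (1 + E) + 1 / (clip J * (1 + E)) = 1 / clip J"
    using clip_excess(1)[of J]
  proof (elim disjE conjE)
    assume "\<bar>J - clip J\<bar> = 0"
    then show ?thesis using k0 by (simp add: r_def E_def)
  next
    assume "clip J = 1" "J - clip J > 0"
    then have "r = E" by (simp add: r_def E_def)
    then show ?thesis using h \<open>clip J = 1\<close> by simp
  next
    assume "clip J = - 1" "J - clip J < 0"
    then have "r = - E" by (simp add: r_def E_def algebra_simps)
    then have "r / (1 + E) + 1 / (clip J * (1 + E)) = - (E / (1 + E) + 1 / (1 + E))"
      using \<open>clip J = - 1\<close> by (simp flip: minus_add_distrib)
    then show ?thesis using h \<open>clip J = - 1\<close> by simp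
  qed
  then show ?thesis
    unfolding straighten_def Let_def split_conv r_def[symmetric] rE slope_chart_sc sc_eq_iff
    using gen by blast
qed

text \<open>The damping over time t is again a quotient of denominators, 1 + E at the times T + t
  and T. It equals 1 where J is not clipped, since then |c| \<ge> 1, and elsewhere |c| = 1 / (1 +
  E).\<close>

lemma damping_slope:
  assumes "J \<noteq> 0"
  shows "damping t (1 / (clip J * (1 + \<bar>J - clip J\<bar> * exp T))) =
           (1 + \<bar>J - clip J\<bar> * exp (T + t)) / (1 + \<bar>J - clip J\<bar> * exp T)"
proof -
  have k: "clip J \<noteq> 0" "\<bar>clip J\<bar> \<le> 1" using assms by (auto simp: clip_def)
  define E where "E = \<bar>J - clip J\<bar> * exp T"
  have E0: "E \<ge> 0" by (simp add: E_def)
  have t: "\<bar>J - clip J\<bar> * exp (T + t) = E * exp t"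
    by (simp add: E_def exp_add)
  show ?thesis
  proof (cases "J = clip J")
    case True
    then show ?thesis
      using k by (subst damping_outer) (auto simp: abs_mult field_simps)
  next
    case False
    then have "\<bar>clip J\<bar> = 1" using clip_excess(1)[of J] by auto
    then have "\<bar>1 / (clip J * (1 + E))\<bar> = 1 / (1 + E)"
      using E0 by (simp add: abs_mult)
    moreover have "1 / (1 + E) \<le> 1"
      using E0 by simp
    ultimately have "min 1 \<bar>1 / (clip J * (1 + E))\<bar> = 1 / (1 + E)"
      by simp
    then have "damping t (1 / (clip J * (1 + E))) = 1 / (1 + E) + (1 - 1 / (1 + E)) * exp t"
      unfolding damping_def by simp
    also have "\<dots> = (1 + E * exp t) / (1 + E)"
      using E0 by (simp add: field_simps)
    finally show ?thesis
      unfolding t E_def[symmetric] .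
  qed
qed

text \<open>The quotients telescope as in the chart of the band. The label 0 is left out because its
  orbit lies at infinity.\<close>

lemma reeb_flow_slope:
  assumes "J \<noteq> 0"
  shows "reeb_flow t (slope_chart (straighten (T, J))) = slope_chart (straighten (T + t, J))"
proof -
  define E where "E = (\<lambda>T. 1 + \<bar>J - clip J\<bar> * exp T)"
  have E: "E u > 0" for u
    unfolding E_def by (intro add_pos_nonneg) auto
  have k: "clip J \<noteq> 0" using assms by (auto simp: clip_def)
  have "reeb_flow t (slope_chart (straighten (T, J))) =
      sc (T - 1 / clip J / 2 - 2 * ln (E T) + t - 2 * ln (E (T + t) / E T)) (1 / (clip J * E T) / (E (T + t) / E T))"
    unfolding slope_straighten[OF assms] reeb_flow_sc damping_slope[OF assms] E_def ..
  also have "\<dots> = sc (T + t - 1 / clip J / 2 - 2 * ln (E (T + t))) (1 / (clip J * E (T + t)))"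
    using E[of T] E[of "T + t"] k by (simp add: sc_eq_iff ln_div)
  also have "\<dots> = slope_chart (straighten (T + t, J))"
    unfolding slope_straighten[OF assms] E_def ..
  finally show ?thesis .
qed

section \<open>The plane\<close>

text \<open>For \<delta> < 1 the bound lies where k is constant in time, and an excess only raises k
  above 1; so the labels J > \<delta> fill exactly k > \<delta>.\<close>

lemma range_slope_straighten:
  assumes "0 < \<delta>" "\<delta> < 1"
  shows "slope_chart ` straighten ` {z. snd z > \<delta>} = {z. 0 < fst z - snd z \<and> fst z - snd z < 1 / \<delta>}"
proof
  show "slope_chart ` straighten ` {z. snd z > \<delta>} \<subseteq> {z. 0 < fst z - snd z \<and> fst z - snd z < 1 / \<delta>}"
  proof clarsimp
    fix T J assume J: "\<delta> < J"
    have "clip J > \<delta>" using J assms by (simp add: clip_def)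
    moreover have "clip J * (1 + \<bar>(J - clip J) * exp T\<bar>) \<ge> clip J"
      using \<open>clip J > \<delta>\<close> assms by (simp add: mult_le_cancel_left1)
    ultimately have "snd (straighten (T, J)) > \<delta>"
      by (simp add: straighten_def Let_def)
    then show "snd (slope_chart (straighten (T, J))) < fst (slope_chart (straighten (T, J))) \<and>
           fst (slope_chart (straighten (T, J))) - snd (slope_chart (straighten (T, J))) < 1 / \<delta>"
      using assms by (cases "straighten (T, J)") (simp add: slope_chart_def frac_less2)
  qed
  show "{z. 0 < fst z - snd z \<and> fst z - snd z < 1 / \<delta>} \<subseteq> slope_chart ` straighten ` {z. snd z > \<delta>}"
  proof
    fix z :: "real \<times> real" assume z: "z \<in> {z. 0 < fst z - snd z \<and> fst z - snd z < 1 / \<delta>}"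
    define k where "k = 1 / (fst z - snd z)"
    have "k > 1 / (1 / \<delta>)"
      unfolding k_def using z assms by (intro divide_strict_left_mono) auto
    then have k: "k > \<delta>" by simp
    have zk: "z = slope_chart (straighten (unstraighten (fst z, k)))"
      by (cases z) (simp add: straighten_unstraighten slope_chart_def k_def)
    have "clip k > \<delta>" "k - clip k \<ge> 0"
      using k assms by (auto simp: clip_def)
    then have "snd (unstraighten (fst z, k)) > \<delta>"
      by (simp add: unstraighten_def Let_def add_strict_increasing2 add_pos_nonneg
           less_le_trans[OF _ add_increasing2] )
    then show "z \<in> slope_chart ` straighten ` {z. snd z > \<delta>}"
      using zk by blast
  qed
qed

text \<open>The orbits with label J > \<delta>, the half-line of labels being unrolled by exp. For 0
  < \<delta> < 1 the strip contains the whole Reeb strip 0 < c < 1 and the line c = 1, so its edges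
  are c = 0, that is k = \<infinity>, and c = 1 / \<delta>.\<close>

definition side_chart :: "real \<Rightarrow> real \<times> real \<Rightarrow> real \<times> real" where
  "side_chart \<delta> = (\<lambda>(T, u). slope_chart (straighten (T, \<delta> + exp u)))"

lemma range_side_chart:
  assumes "0 < \<delta>" "\<delta> < 1"
  shows "range (side_chart \<delta>) = {z. 0 < fst z - snd z \<and> fst z - snd z < 1 / \<delta>}"
proof -
  have "range (side_chart \<delta>) = slope_chart ` straighten ` {z. snd z > \<delta>}"
  proof
    show "slope_chart ` straighten ` {z. snd z > \<delta>} \<subseteq> range (side_chart \<delta>)"
    proof clarsimp
      fix T J assume "\<delta> < J"
      then have "slope_chart (straighten (T, J)) = side_chart \<delta> (T, ln (J - \<delta>))"
        by (simp add: side_chart_def)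
      then show "slope_chart (straighten (T, J)) \<in> range (side_chart \<delta>)"
        by blast
    qed
  qed (auto simp: side_chart_def)
  then show ?thesis
    using range_slope_straighten[OF assms] by simp
qed

lemma flow_chart_side:
  assumes "0 < \<delta>"
  shows "flow_chart plane reeb_flow (side_chart \<delta>)"
proof (rule flow_chart_plane)
  have pos: "\<delta> + exp u > 0" for u
    using assms by (simp add: add_pos_pos)
  have nz: "snd (straighten (T, \<delta> + exp u)) \<noteq> 0" for T u
    using snd_straighten_eq_0_iff pos[of u] by (metis less_irrefl)
  have "continuous_on UNIV (\<lambda>z. straighten (fst z, \<delta> + exp (snd z)))"
    by (intro continuous_on_compose2[OF continuous_on_straighten] continuous_intros) auto
  then show "continuous_on UNIV (side_chart \<delta>)"
    unfolding side_chart_def slope_chart_def split_beta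
    by (intro continuous_intros) (auto simp: nz intro: continuous_on_fst continuous_on_snd)
  show "inj (side_chart \<delta>)"
  proof (rule injI)
    fix z w assume eq: "side_chart \<delta> z = side_chart \<delta> w"
    obtain T u T' u' where zw: "z = (T, u)" "w = (T', u')"
      by (cases z, cases w)
    have "straighten (T, \<delta> + exp u) = straighten (T', \<delta> + exp u')"
      using eq unfolding zw side_chart_def slope_chart_def
      by (cases "straighten (T, \<delta> + exp u)", cases "straighten (T', \<delta> + exp u')") auto
    then have "(T, \<delta> + exp u) = (T', \<delta> + exp u')"
      by (rule injD[OF inj_straighten])
    then show "z = w"
      by (simp add: zw)
  qed
  show "reeb_flow t (side_chart \<delta> z) = side_chart \<delta> (strip_flow t z)" for t z
    using reeb_flow_slope[of "\<delta> + exp (snd z)" t "fst z"] pos[of "snd z"]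
    by (cases z) (simp add: side_chart_def strip_flow_def)
qed

lemma flow_chart_swap:
  assumes "flow_chart plane reeb_flow e"
  shows "flow_chart plane reeb_flow (swap \<circ> e)"
  using assms
  by (intro flow_chart_plane)
    (auto simp: flow_chart_def reeb_flow_swap inj_compose[OF inj_swap] intro: continuous_on_compose2[OF continuous_on_swap[of UNIV]])

lemma range_swap: "range (swap \<circ> e) = {z. swap z \<in> range e}"
  by (auto simp: image_iff) (metis swap_swap)+

lemma frontier_band:
  assumes "lo < hi"
  shows "plane frontier_of {z :: real \<times> real. lo < fst z - snd z \<and> fst z - snd z < hi} =
           {z. fst z - snd z = lo} \<union> {z. fst z - snd z = hi}"
proof -
  let ?c = "\<lambda>z :: real \<times> real. fst z - snd z"
  have cont: "continuous_on UNIV ?c"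
    by (intro continuous_intros)
  have op: "open {z. lo < ?c z \<and> ?c z < hi}"
    by (intro open_Collect_conj open_Collect_less continuous_intros)
  have op': "open {z. ?c z < lo \<or> hi < ?c z}"
    by (intro open_Collect_disj open_Collect_less continuous_intros)
  have cl: "z \<in> closure {z. lo < ?c z \<and> ?c z < hi}" if z: "?c z = lo \<or> ?c z = hi" for z
  proof (rule sc_cases[of z])
    fix s c assume zsc: "z = sc s c"
    then have c: "c = lo \<or> c = hi"
      using z by (simp add: fst_sc snd_sc)
    \<comment> \<open>Boundary points are approached along the segment to the middle line c = m; the
      factor is positive and at most 1, so the points stay strictly inside.\<close>
    define m where "m = (lo + hi) / 2"
    define f where "f = (\<lambda>n. sc s (c + (m - c) * inverse (real (Suc n))))"
    have "f \<longlonglongrightarrow> sc s (c + (m - c) * 0)"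
      unfolding f_def sc_def by (intro tendsto_intros LIMSEQ_inverse_real_of_nat) auto
    then have "f \<longlonglongrightarrow> z"
      by (simp add: zsc)
    moreover have "f n \<in> {z. lo < ?c z \<and> ?c z < hi}" for n
    proof -
      define e where "e = inverse (real (Suc n))"
      have e: "0 < e" "e \<le> 1"
        by (auto simp: e_def field_simps)
      define d where "d = (hi - lo) * e"
      have "d > 0" "d \<le> hi - lo"
        using e assms by (auto simp: d_def mult_le_cancel_left1)
      moreover have "(m - lo) * e = d / 2" "(m - hi) * e = - (d / 2)"
        by (simp_all add: m_def d_def field_simps)
      ultimately show ?thesis
        using c unfolding f_def e_def[symmetric] mem_Collect_eq diff_sc by (elim disjE) simp_all
    qed
    ultimately show ?thesis
      unfolding closure_sequential by blast
  qed
  have compl: "UNIV - ({z. lo < ?c z \<and> ?c z < hi} \<union> ({z. ?c z = lo} \<union> {z. ?c z = hi})) = {z. ?c z < lo \<or> hi < ?c z}"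
    using assms by auto
  show ?thesis
    using op op' cl assms by (intro frontier_of_eqI) (auto simp: compl)
qed

section \<open>Escape to infinity\<close>

text \<open>Both coordinates have to diverge, and with equal sign. In the plane this leaves no limit
  points; on the torus it makes the orbit converge to (\<infinity>, \<infinity>) instead of another
  point at infinity.\<close>

definition escapes :: "(real \<Rightarrow> real \<times> real) \<Rightarrow> real filter \<Rightarrow> bool" where
  "escapes f F \<longleftrightarrow> filterlim (\<lambda>t. fst (f t)) at_top F \<and> filterlim (\<lambda>t. snd (f t)) at_top F \<or>
                   filterlim (\<lambda>t. fst (f t)) at_bot F \<and> filterlim (\<lambda>t. snd (f t)) at_bot F"

lemma escapes_sc:
  assumes lim: "filterlim s at_top F \<or> filterlim s at_bot F" and K: "\<And>t. \<bar>c t\<bar> \<le> K"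
  shows "escapes (\<lambda>t. sc (s t) (c t)) F"
  using lim
proof
  assume s: "filterlim s at_top F"
  have "filterlim (\<lambda>t. - K / 2 + s t) at_top F"
    using s by (rule filterlim_tendsto_add_at_top[OF tendsto_const])
  moreover have "- K / 2 + s t \<le> s t + c t / 2" "- K / 2 + s t \<le> s t - c t / 2" for t
    using K[of t] by auto
  ultimately show ?thesis
    unfolding escapes_def fst_sc snd_sc by (blast intro: filterlim_at_top_mono always_eventually)
next
  assume s: "filterlim s at_bot F"
  then have "filterlim (\<lambda>t. - s t) at_top F"
    by (simp add: filterlim_uminus_at_bot)
  then have "filterlim (\<lambda>t. - K / 2 + - s t) at_top F"
    by (rule filterlim_tendsto_add_at_top[OF tendsto_const])
  moreover have "- K / 2 + - s t \<le> - (s t + c t / 2)" "- K / 2 + - s t \<le> - (s t - c t / 2)" for t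
    using K[of t] by auto
  ultimately show ?thesis
    unfolding escapes_def fst_sc snd_sc filterlim_uminus_at_bot
    by (blast intro: filterlim_at_top_mono always_eventually)
qed

lemma escapes_diag_flow: "escapes (\<lambda>t. diag_flow t z) at_top" "escapes (\<lambda>t. diag_flow t z) at_bot"
proof -
  obtain s c where z: "z = sc s c" by (rule sc_cases)
  have 1: "filterlim (\<lambda>t. s + t) at_top at_top" and 2: "filterlim (\<lambda>t. s + t) at_bot at_bot"
    by real_asymp+
  then show "escapes (\<lambda>t. diag_flow t z) at_top" "escapes (\<lambda>t. diag_flow t z) at_bot"
    unfolding z diag_flow_sc by (intro escapes_sc[of _ _ _ "\<bar>c\<bar>"]; simp)+
qed

lemma escapes_reeb_flow: "escapes (\<lambda>t. reeb_flow t z) at_top" "escapes (\<lambda>t. reeb_flow t z) at_bot"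
proof -
  obtain s c where z: "z = sc s c" by (rule sc_cases)
  define m where "m = min 1 \<bar>c\<bar>"
  have bound: "\<bar>c / damping t c\<bar> \<le> max 1 \<bar>c\<bar>" for t
  proof (cases "\<bar>c\<bar> \<ge> 1")
    case False
    then have "(1 - \<bar>c\<bar>) * exp t \<ge> 0"
      by simp
    with False have "\<bar>c\<bar> \<le> damping t c"
      by (simp add: damping_def)
    then show ?thesis
      using damping_pos[of t c] by (simp add: abs_divide le_max_iff_disj)
  qed (simp add: damping_outer)
  have D: "damping t c = m + (1 - m) * exp t" for t
    by (simp add: damping_def m_def)
  consider "m = 1" | "m = 0" | "0 < m" "m < 1"
    unfolding m_def by linarith
  then have "(filterlim (\<lambda>t. s + t - 2 * ln (damping t c)) at_top at_top \<or> 
              filterlim (\<lambda>t. s + t - 2 * ln (damping t c)) at_bot at_top) \<and>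
      (filterlim (\<lambda>t. s + t - 2 * ln (damping t c)) at_top at_bot \<or>
       filterlim (\<lambda>t. s + t - 2 * ln (damping t c)) at_bot at_bot)"
  proof cases
    case 1
    have "filterlim (\<lambda>t. s + t) at_top at_top" "filterlim (\<lambda>t. s + t) at_bot at_bot"
      by real_asymp+
    then show ?thesis
      by (simp add: D 1)
  next
    case 2
    have "filterlim (\<lambda>t. s - t) at_bot at_top" "filterlim (\<lambda>t. s - t) at_top at_bot"
      by real_asymp+
    then show ?thesis
      by (simp add: D 2)
  next
    case 3
    \<comment> \<open>Up to a bounded term t - 2 * ln (m + (1 - m) * exp t) behaves like t in the
      past and like -t in the future, so a Reeb orbit leaves towards s = -\<infinity> at both
      ends.\<close>
    have "filterlim (\<lambda>t. s + t - 2 * ln (m + (1 - m) * exp t)) at_bot at_top"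
      "filterlim (\<lambda>t. s + t - 2 * ln (m + (1 - m) * exp t)) at_bot at_bot"
      using 3 by real_asymp+
    then show ?thesis
      by (simp add: D)
  qed
  then show "escapes (\<lambda>t. reeb_flow t z) at_top" "escapes (\<lambda>t. reeb_flow t z) at_bot"
    unfolding z reeb_flow_sc using bound by (auto intro!: escapes_sc)
qed

lemma escapes_no_limit:
  assumes "escapes f F" "filterlim \<tau> F sequentially"
  shows "\<not> (\<lambda>n. f (\<tau> n)) \<longlonglongrightarrow> u"
proof
  assume "(\<lambda>n. f (\<tau> n)) \<longlonglongrightarrow> u"
  then have l: "(\<lambda>n. fst (f (\<tau> n))) \<longlonglongrightarrow> fst u"
    by (rule tendsto_fst)
  have "filterlim (\<lambda>n. fst (f (\<tau> n))) at_top sequentially \<or> filterlim (\<lambda>n. fst (f (\<tau> n))) at_bot sequentially"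
    using assms filterlim_compose unfolding escapes_def by blast
  then show False
    using l not_tendsto_and_filterlim_at_infinity[OF sequentially_bot l]
      filterlim_at_top_imp_at_infinity filterlim_at_bot_imp_at_infinity by blast
qed

lemma plane_limits_empty:
  assumes "escapes (\<lambda>t. \<Phi> t q) at_top" "escapes (\<lambda>t. \<Phi> t q) at_bot"
  shows "alpha' plane \<Phi> q = {}" "omega' plane \<Phi> q = {}"
  using escapes_no_limit[OF assms(1)] escapes_no_limit[OF assms(2)]
  by (auto simp: alpha'_def omega'_def alpha_limit_def omega_limit_def)

lemma ordinary_plane:
  assumes "flow_chart plane \<Phi> e" "q \<in> range e" "orbit \<Phi> a \<noteq> orbit \<Phi> b"
    and "\<And>z. escapes (\<lambda>t. \<Phi> t z) at_top" "\<And>z. escapes (\<lambda>t. \<Phi> t z) at_bot"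
    and "plane frontier_of range e = orbit \<Phi> a \<union> orbit \<Phi> b"
  shows "ordinary plane \<Phi> q"
  using assms plane_limits_empty[of \<Phi>] by (intro ordinary_flow_chart[of plane \<Phi> e q a b "{}"]) auto

section \<open>All orbits of the plane flows are ordinary\<close>

text \<open>The whole plane is a strip for the translation, but it has no boundary orbits. The
  arctangent cuts out a band of width \<pi> around c = k, which has two.\<close>

definition slab_chart :: "real \<Rightarrow> real \<times> real \<Rightarrow> real \<times> real" where
  "slab_chart k = (\<lambda>(T, u). sc T (k + arctan u))"

lemma flow_chart_slab: "flow_chart plane diag_flow (slab_chart k)"
proof (rule flow_chart_plane)
  show "continuous_on UNIV (slab_chart k)"
    unfolding slab_chart_def split_beta by (intro continuous_intros)
  show "inj (slab_chart k)"
    by (auto simp: inj_def slab_chart_def sc_eq_iff arctan_eq_iff)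
qed (auto simp: slab_chart_def strip_flow_def diag_flow_sc)

lemma range_slab_chart: "range (slab_chart k) = {z. k - pi / 2 < fst z - snd z \<and> fst z - snd z < k + pi / 2}"
proof
  show "range (slab_chart k) \<subseteq> {z. k - pi / 2 < fst z - snd z \<and> fst z - snd z < k + pi / 2}"
    using arctan_bounded by (auto simp: slab_chart_def diff_sc)
  show "{z. k - pi / 2 < fst z - snd z \<and> fst z - snd z < k + pi / 2} \<subseteq> range (slab_chart k)"
  proof
    fix z :: "real \<times> real" assume z: "z \<in> {z. k - pi / 2 < fst z - snd z \<and> fst z - snd z < k + pi / 2}"
    obtain s c where sc: "z = sc s c" by (rule sc_cases)
    then have "z = slab_chart k (s, tan (c - k))"
      using z by (simp add: slab_chart_def diff_sc arctan_tan)
    then show "z \<in> range (slab_chart k)"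
      by blast
  qed
qed

lemma lines_neq: "k \<noteq> k' \<Longrightarrow> {w :: real \<times> real. fst w - snd w = k} \<noteq> {w. fst w - snd w = k'}"
proof
  assume "k \<noteq> k'" "{w :: real \<times> real. fst w - snd w = k} = {w. fst w - snd w = k'}"
  moreover have "sc 0 k \<in> {w. fst w - snd w = k}"
    by (simp add: diff_sc)
  ultimately have "sc 0 k \<in> {w. fst w - snd w = k'}"
    by blast
  then show False
    using \<open>k \<noteq> k'\<close> by (simp add: diff_sc)
qed

lemma ordinary_diag_flow: "ordinary plane diag_flow q"
proof -
  obtain s k where q: "q = sc s k" by (rule sc_cases)
  show ?thesis
  proof (rule ordinary_plane[OF flow_chart_slab[of k], where a = "sc 0 (k - pi / 2)" and b = "sc 0 (k + pi / 2)"])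
    show "q \<in> range (slab_chart k)"
      by (simp add: range_slab_chart q fst_sc snd_sc)
    show "orbit diag_flow (sc 0 (k - pi / 2)) \<noteq> orbit diag_flow (sc 0 (k + pi / 2))"
      unfolding orbit_diag_flow diff_sc using pi_gt_zero by (intro lines_neq) linarith
    show "plane frontier_of range (slab_chart k) =
        orbit diag_flow (sc 0 (k - pi / 2)) \<union> orbit diag_flow (sc 0 (k + pi / 2))"
      unfolding range_slab_chart orbit_diag_flow diff_sc by (intro frontier_band) simp
  qed (rule escapes_diag_flow)+
qed

lemma ordinary_reeb_flow: "ordinary plane reeb_flow q"
proof -
  obtain s k where q: "q = sc s k" by (rule sc_cases)
  have orb: "orbit reeb_flow (sc 0 c) = {w. fst w - snd w = c}" if "c = 0 \<or> \<bar>c\<bar> \<ge> 1" for c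
    using that orbit_reeb_flow[of "sc 0 c"] by (auto simp: diff_sc fst_sc snd_sc)
  consider "\<bar>k\<bar> < 1" | "k \<ge> 1" | "k \<le> -1"
    by linarith
  then show ?thesis
  proof cases
    case 1
    have range: "range core_chart = {z. - 1 < fst z - snd z \<and> fst z - snd z < 1}"
      unfolding range_core_chart by auto
    show ?thesis
    proof (rule ordinary_plane[OF flow_chart_core, where a = "sc 0 (- 1)" and b = "sc 0 1"])
      show "q \<in> range core_chart"
        using 1 by (simp add: range_core_chart q fst_sc snd_sc)
      show "orbit reeb_flow (sc 0 (- 1)) \<noteq> orbit reeb_flow (sc 0 1)"
        by (simp add: orb lines_neq)
      show "plane frontier_of range core_chart = orbit reeb_flow (sc 0 (- 1)) \<union> orbit reeb_flow (sc 0 1)"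
        unfolding range by (subst frontier_band) (simp_all add: orb)
    qed (rule escapes_reeb_flow)+
  next
    case 2
    \<comment> \<open>This \<delta> puts the second edge at c = k + 1, beyond the given orbit; k
      \<ge> 1 keeps \<delta> below 1.\<close>
    have \<delta>: "0 < 1 / (k + 1)" "1 / (k + 1) < 1"
      using 2 by auto
    have range: "range (side_chart (1 / (k + 1))) = {z. 0 < fst z - snd z \<and> fst z - snd z < k + 1}"
      using range_side_chart[OF \<delta>] by simp
    show ?thesis
    proof (rule ordinary_plane[OF flow_chart_side[OF \<delta>(1)], where a = "sc 0 0" and b = "sc 0 (k + 1)"])
      show "q \<in> range (side_chart (1 / (k + 1)))"
        using 2 by (simp add: range q fst_sc snd_sc)
      show "orbit reeb_flow (sc 0 0) \<noteq> orbit reeb_flow (sc 0 (k + 1))"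
        using 2 lines_neq[of 0 "k + 1"] by (simp add: orb)
      show "plane frontier_of range (side_chart (1 / (k + 1))) = orbit reeb_flow (sc 0 0) \<union> orbit reeb_flow (sc 0 (k + 1))"
        unfolding range using 2 by (subst frontier_band) (simp_all add: orb)
    qed (rule escapes_reeb_flow)+
  next
    case 3
    have \<delta>: "0 < 1 / (1 - k)" "1 / (1 - k) < 1"
      using 3 by auto
    have range: "range (swap \<circ> side_chart (1 / (1 - k))) = {z. k - 1 < fst z - snd z \<and> fst z - snd z < 0}"
      unfolding range_swap range_side_chart[OF \<delta>] diff_swap mem_Collect_eq using 3 by auto
    show ?thesis
    proof (rule ordinary_plane[OF flow_chart_swap[OF flow_chart_side[OF \<delta>(1)]], where a = "sc 0 (k - 1)" and b = "sc 0 0"])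
      show "q \<in> range (swap \<circ> side_chart (1 / (1 - k)))"
        using 3 unfolding range by (simp add: q fst_sc snd_sc)
      show "orbit reeb_flow (sc 0 (k - 1)) \<noteq> orbit reeb_flow (sc 0 0)"
        using 3 lines_neq[of "k - 1" 0] by (simp add: orb)
      show "plane frontier_of range (swap \<circ> side_chart (1 / (1 - k))) = orbit reeb_flow (sc 0 (k - 1)) \<union> orbit reeb_flow (sc 0 0)"
        unfolding range using 3 by (subst frontier_band) (simp_all add: orb)
    qed (rule escapes_reeb_flow)+
  qed
qed

lemma is_flow_diag_flow: "is_flow plane diag_flow"
proof (rule is_flow_of_charts)
  fix q :: "real \<times> real"
  have "q \<in> range (slab_chart (fst q - snd q))"
    by (simp add: range_slab_chart)
  then show "\<exists>e. flow_chart plane diag_flow e \<and> q \<in> range e"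
    using flow_chart_slab by blast
qed

lemma reeb_flow_charts: "\<exists>e. flow_chart plane reeb_flow e \<and> q \<in> range e"
proof -
  obtain s k where q: "q = sc s k" by (rule sc_cases)
  consider "\<bar>k\<bar> < 1" | "k \<ge> 1" | "k \<le> -1"
    by linarith
  then show ?thesis
  proof cases
    case 1
    then show ?thesis
      using flow_chart_core range_core_chart by (auto simp: q fst_sc snd_sc)
  next
    case 2
    then have "q \<in> range (side_chart (1 / (k + 1)))"
      by (subst range_side_chart) (auto simp: q fst_sc snd_sc)
    then show ?thesis
      using flow_chart_side[of "1 / (k + 1)"] 2 by auto
  next
    case 3
    then have "q \<in> range (swap \<circ> side_chart (1 / (1 - k)))"
      unfolding range_swap by (subst range_side_chart) (auto simp: q fst_sc snd_sc swap_sc)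
    then show ?thesis
      using flow_chart_swap[OF flow_chart_side[of "1 / (1 - k)"]] 3 by auto
  qed
qed

lemma is_flow_reeb_flow: "is_flow plane reeb_flow"
  using reeb_flow_charts by (intro is_flow_of_charts) 

section \<open>Inequivalence in the plane\<close>

lemma prolongs_reeb_flow:
  assumes "\<bar>\<epsilon>\<bar> = 1"
  shows "prolongs plane reeb_flow (sc 0 \<epsilon>) (sc 0 0)"
proof -
  \<comment> \<open>Starting at distance exp (- n / 2) from |c| = 1 and running for time n gives a
    damping of order exp (n / 2). Then c tends to 0 and the shift n - 2 * ln D tends to 0 as well,
    so the points converge on the reversed line instead of escaping.\<close>
  define m where "m = (\<lambda>n. 1 - exp (- real n / 2))"
  define D where "D = (\<lambda>n. m n + (1 - m n) * exp (real n))"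
  have "m n \<ge> 0" for n
    by (simp add: m_def)
  then have "min 1 \<bar>\<epsilon> * m n\<bar> = m n" for n
    using assms by (simp add: abs_mult) (simp add: m_def)
  then have D: "damping (real n) (\<epsilon> * m n) = D n" for n
    by (simp add: damping_def D_def)
  have m_lim: "m \<longlonglongrightarrow> 1"
    unfolding m_def by real_asymp
  have s_lim: "(\<lambda>n. real n - 2 * ln (D n)) \<longlonglongrightarrow> 0"
    unfolding m_def D_def by real_asymp
  have c_lim: "(\<lambda>n. m n / D n) \<longlonglongrightarrow> 0"
    unfolding m_def D_def by real_asymp
  show ?thesis
  proof (rule prolongs_of_sequences[where f = "\<lambda>n. sc 0 (\<epsilon> * m n)" and \<tau> = real])
    have "(\<lambda>n. sc 0 (\<epsilon> * m n)) \<longlonglongrightarrow> sc 0 (\<epsilon> * 1)"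
      unfolding sc_def by (intro tendsto_intros m_lim) auto
    then show "limitin plane (\<lambda>n. sc 0 (\<epsilon> * m n)) (sc 0 \<epsilon>) sequentially"
      by simp
    have "(\<lambda>n. sc (real n - 2 * ln (D n)) (\<epsilon> * (m n / D n))) \<longlonglongrightarrow> sc 0 (\<epsilon> * 0)"
      unfolding sc_def by (intro tendsto_intros s_lim c_lim) auto
    then show "limitin plane (\<lambda>n. reeb_flow (real n) (sc 0 (\<epsilon> * m n))) (sc 0 0) sequentially"
      by (simp add: reeb_flow_sc D)
  qed
qed

lemma not_prolongs_diag_flow:
  assumes "fst z - snd z \<noteq> fst w - snd w"
  shows "\<not> prolongs plane diag_flow z w"
proof -
  let ?c = "\<lambda>z :: real \<times> real. fst z - snd z"
  define m where "m = (?c z + ?c w) / 2"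
  have op: "open {z. ?c z < m}" "open {z. m < ?c z}"
    by (intro open_Collect_less continuous_intros)+
  have inv: "?c (diag_flow t q) = ?c q" for t q
    by (simp add: diag_flow_def split_beta)
  show ?thesis
  proof (cases "?c z < ?c w")
    case True
    then show ?thesis
      using op inv by (intro not_prolongs[of _ "{z. ?c z < m}" _ "{z. m < ?c z}"]; unfold m_def mem_Collect_eq inv) auto
  next
    case False
    then show ?thesis
      using op inv assms by (intro not_prolongs[of _ "{z. m < ?c z}" _ "{z. ?c z < m}"]; unfold m_def mem_Collect_eq inv) auto
  qed
qed

text \<open>The lines c = 1 and c = 0 are non-separated, hence so are their images; but
  non-separated points of the translation lie on one line. The two orbits would be mapped into
  one.\<close>

lemma not_equivalent_plane: "\<not> topologically_equivalent plane reeb_flow plane diag_flow"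
proof
  assume "topologically_equivalent plane reeb_flow plane diag_flow"
  then obtain h where h: "homeomorphic_map plane plane h"
      "carries_orbits h reeb_flow (topspace plane) diag_flow (topspace plane)"
    unfolding topologically_equivalent_def by blast
  have "prolongs plane diag_flow (h (sc 0 1)) (h (sc 0 0))"
    by (rule prolongs_homeomorphic_map[OF h]) (auto intro: prolongs_reeb_flow)
  then have "fst (h (sc 0 1)) - snd (h (sc 0 1)) = fst (h (sc 0 0)) - snd (h (sc 0 0))"
    using not_prolongs_diag_flow by blast
  then have "h (sc 0 0) \<in> orbit diag_flow (h (sc 0 1))"
    by (simp add: orbit_diag_flow)
  then have "sc 0 0 \<in> orbit reeb_flow (sc 0 1)"
    by (intro orbit_homeomorphic_map[OF h]) auto
  moreover have "orbit reeb_flow (sc 0 1) = {w. fst w - snd w = 1}"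
    using orbit_reeb_flow[of "sc 0 1"] by (simp add: diff_sc)
  ultimately show False
    by (simp add: diff_sc)
qed

lemma singular_points_plane:
  assumes "\<And>z. escapes (\<lambda>t. \<Phi> t z) at_top"
  shows "singular_points plane \<Phi> = {}"
proof -
  have "orbit \<Phi> q \<noteq> {q}" for q
  proof
    assume "orbit \<Phi> q = {q}"
    then have "\<Phi> t q = q" for t
      by (auto simp: orbit_def)
    then show False
      using escapes_no_limit[OF assms[of q] filterlim_real_sequentially, of q] by simp
  qed
  then show ?thesis
    by (auto simp: singular_points_def)
qed

lemma configurations_plane: "have_equivalent_configurations plane reeb_flow diag_flow"
proof (rule have_equivalent_configurations_of_common_orbit[where Z = "{}" and r = "sc 0 1"])
  show "separatrix_set plane reeb_flow = {}" "separatrix_set plane diag_flow = {}"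
    by (auto simp: separatrix_set_def ordinary_reeb_flow ordinary_diag_flow)
  show "connectedin plane (topspace plane - {})"
    using connected_UNIV by simp
  show "reeb_flow t q = diag_flow t q" if "q \<in> {} \<union> orbit reeb_flow (sc 0 1)" for q t
    using that orbit_reeb_flow[of "sc 0 1"] by (intro reeb_flow_outer) (simp add: diff_sc)
  show "reeb_flow 0 (sc 0 1) = sc 0 1"
    by (simp add: reeb_flow_sc damping_outer)
qed simp

section \<open>Circle coordinates on the torus\<close>

lemma torus_proj_eq_iff: "torus_proj v = torus_proj w \<longleftrightarrow> fst v - fst w \<in> \<int> \<and> snd v - snd w \<in> \<int>"
proof
  assume "torus_proj v = torus_proj w"
  moreover have "v \<in> torus_proj v"
    by (simp add: torus_proj_def)
  ultimately show "fst v - fst w \<in> \<int> \<and> snd v - snd w \<in> \<int>"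
    by (simp add: torus_proj_def)
next
  assume *: "fst v - fst w \<in> \<int> \<and> snd v - snd w \<in> \<int>"
  have "a - p \<in> \<int> \<longleftrightarrow> a - q \<in> \<int>" if "p - q \<in> \<int>" for a p q :: real
  proof -
    have "a - q = (a - p) + (p - q)" "a - p = (a - q) - (p - q)"
      by simp_all
    then show ?thesis
      using that by (metis Ints_add Ints_diff)
  qed
  with * show "torus_proj v = torus_proj w"
    unfolding torus_proj_def by blast
qed

lemma continuous_map_torus_proj: "continuous_map plane torus torus_proj"
  using quotient_map_torus_proj by (rule quotient_imp_continuous_map)

lemma open_map_torus_proj: "open_map plane torus torus_proj"
  unfolding open_map_def
proof (intro allI impI)
  fix V :: "(real \<times> real) set" assume "openin plane V"
  then have "open V" by simp
  have "torus_proj -` torus_proj ` V = (\<Union>d\<in>\<int> \<times> \<int>. (+) d ` V)"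
  proof (intro set_eqI iffI)
    fix w assume "w \<in> torus_proj -` torus_proj ` V"
    then obtain v where "v \<in> V" "torus_proj w = torus_proj v"
      by auto
    then have "fst w - fst v \<in> \<int>" "snd w - snd v \<in> \<int>"
      unfolding torus_proj_eq_iff by blast+
    then have "w - v \<in> \<int> \<times> \<int>"
      by (simp add: mem_Times_iff)
    then show "w \<in> (\<Union>d\<in>\<int> \<times> \<int>. (+) d ` V)"
      using \<open>v \<in> V\<close> by (intro UN_I[of "w - v"] image_eqI[of _ _ v]) auto
  next
    fix w assume "w \<in> (\<Union>d\<in>\<int> \<times> \<int>. (+) d ` V)"
    then obtain d v where "d \<in> \<int> \<times> \<int>" "v \<in> V" "w = d + v"
      by auto
    then have "torus_proj w = torus_proj v"
      by (simp add: torus_proj_eq_iff mem_Times_iff)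
    then show "w \<in> torus_proj -` torus_proj ` V"
      using \<open>v \<in> V\<close> by auto
  qed
  moreover have "open (\<Union>d\<in>\<int> \<times> \<int>. (+) d ` V)"
    using \<open>open V\<close> by (intro open_UN ballI open_translation)
  ultimately show "openin torus (torus_proj ` V)"
    by (auto simp: openin_torus)
qed

text \<open>The two exponentials separate the cosets, so they descend to a continuous injection into
  a Hausdorff space.\<close>

lemma Hausdorff_space_torus: "Hausdorff_space torus"
proof -
  define f where "f = (\<lambda>v :: real \<times> real. (cis (2 * pi * fst v), cis (2 * pi * snd v)))"
  have cis_eq: "cis (2 * pi * a) = cis (2 * pi * b) \<longleftrightarrow> a - b \<in> \<int>" for a b :: real
  proof -
    have "cis (2 * pi * a) = cis (2 * pi * b) \<longleftrightarrow> (\<exists>n::int. 2 * pi * a = 2 * pi * b + 2 * pi * n)"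
      unfolding complex_eq_iff by (simp add: sin_cos_eq_iff[symmetric] conj_commute)
    also have "\<dots> \<longleftrightarrow> (\<exists>n::int. a - b = n)"
    proof -
      have "2 * pi * a = 2 * pi * b + 2 * pi * n \<longleftrightarrow> 2 * pi * (a - b) = 2 * pi * n" for n
        by (auto simp: right_diff_distrib)
      then show ?thesis by simp
    qed
    finally show ?thesis
      by (auto simp: Ints_def)
  qed
  have f_eq: "f v = f w \<longleftrightarrow> torus_proj v = torus_proj w" for v w
    by (simp add: f_def cis_eq torus_proj_eq_iff)
  have "continuous_map plane euclidean f"
    unfolding f_def cis_conv_exp by (simp, intro continuous_intros)
  then obtain g where g: "continuous_map torus euclidean g" "\<And>v. g (torus_proj v) = f v"
  proof (rule quotient_map_lift_exists[OF quotient_map_torus_proj])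
    show "f v = f w" if "torus_proj v = torus_proj w" for v w
      using that f_eq by blast
  qed auto
  have "inj_on g (topspace torus)"
    by (auto simp: inj_on_def topspace_torus g(2) f_eq)
  then show ?thesis
    using g(1) Hausdorff_space_euclidean Hausdorff_space_injective_preimage by blast
qed

lemma torus_proj_representative: obtains v where "torus_proj w = torus_proj v" "v \<in> {0..<1} \<times> {0..<1}"
proof
  show "torus_proj w = torus_proj (frac (fst w), frac (snd w))"
    by (simp add: torus_proj_eq_iff frac_def)
  show "(frac (fst w), frac (snd w)) \<in> {0..<1} \<times> {0..<1}"
    by (simp add: frac_lt_1)
qed

lemma compact_space_torus: "compact_space torus"
proof -
  have "compactin plane ({0..1} \<times> {0..1})"
    by (simp add: compact_Times)
  then have "compactin torus (torus_proj ` ({0..1} \<times> {0..1}))"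
    using continuous_map_torus_proj by (rule image_compactin)
  moreover have "torus_proj ` ({0..1} \<times> {0..1}) = topspace torus"
  proof
    show "topspace torus \<subseteq> torus_proj ` ({0..1} \<times> {0..1})"
    proof
      fix q assume "q \<in> topspace torus"
      then obtain w where w: "q = torus_proj w" by (auto simp: topspace_torus)
      obtain v where "torus_proj w = torus_proj v" "v \<in> {0..<1} \<times> {0..<1}"
        by (rule torus_proj_representative)
      then show "q \<in> torus_proj ` ({0..1} \<times> {0..1})"
        using w by (auto simp: mem_Times_iff intro!: image_eqI[of _ _ v])
    qed
  qed (auto simp: topspace_torus)
  ultimately show ?thesis
    by (simp add: compact_space_def)
qed

text \<open>Injectivity modulo the lattice makes the lift \<beta> injective, hence open by
  invariance of domain; the projection is open as well.\<close>

lemma torus_embedding: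
  assumes "continuous_on UNIV \<beta>" "inj (\<lambda>z. torus_proj (\<beta> z))"
  shows "continuous_map plane torus (\<lambda>z. torus_proj (\<beta> z))" "open_map plane torus (\<lambda>z. torus_proj (\<beta> z))"
proof -
  show "continuous_map plane torus (\<lambda>z. torus_proj (\<beta> z))"
    using continuous_map_compose[OF _ continuous_map_torus_proj, of plane \<beta>] assms(1) by (simp add: o_def)
  have "inj \<beta>"
    using assms(2) by (auto simp: inj_def)
  then have "open_map plane plane \<beta>"
    using invariance_of_domain[of _ \<beta>] assms(1)
    by (auto simp: open_map_def intro: continuous_on_subset inj_on_subset)
  then show "open_map plane torus (\<lambda>z. torus_proj (\<beta> z))"
    using open_map_compose[OF _ open_map_torus_proj, of plane \<beta>] by (simp add: o_def)
qed

section \<open>The torus as a product of two completed lines\<close>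

text \<open>A homeomorphism of the line onto (0, 1). The ends 0 and 1 agree modulo 1, so they supply
  a single point at infinity.\<close>

definition squash :: "real \<Rightarrow> real" where
  "squash x = 1 / 2 + arctan x / pi"

lemma squash_bounds: "0 < squash x" "squash x < 1"
proof -
  define a where "a = arctan x / pi"
  have "- (1 / 2) < a" "a < 1 / 2"
    using arctan_bounded[of x] by (simp_all add: a_def field_simps)
  then show "0 < squash x" "squash x < 1"
    unfolding squash_def a_def[symmetric] by auto
qed

lemma squash_eq_iff: "squash x = squash y \<longleftrightarrow> x = y"
  by (simp add: squash_def arctan_eq_iff)

lemma continuous_on_squash [continuous_intros]:
  "continuous_on A f \<Longrightarrow> continuous_on A (\<lambda>x. squash (f x))"
  unfolding squash_def by (intro continuous_intros) auto

lemma squash_at_top: "(squash \<longlongrightarrow> 1) at_top"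
proof -
  have "(squash \<longlongrightarrow> 1 / 2 + (pi / 2) / pi) at_top"
    unfolding squash_def[abs_def] by (intro tendsto_intros tendsto_arctan_at_top) simp
  then show ?thesis by simp
qed

lemma squash_at_bot: "(squash \<longlongrightarrow> 0) at_bot"
proof -
  have "(squash \<longlongrightarrow> 1 / 2 + (- (pi / 2)) / pi) at_bot"
    unfolding squash_def[abs_def] by (intro tendsto_intros tendsto_arctan_at_bot) simp
  then show ?thesis by simp
qed

lemma squash_surj:
  assumes "0 < u" "u < 1" shows "squash (tan (pi * (u - 1 / 2))) = u"
proof -
  have "- (pi / 2) < pi * (u - 1 / 2)" "pi * (u - 1 / 2) < pi / 2"
    using assms by (simp_all add: field_simps)
  then show ?thesis
    by (simp add: squash_def arctan_tan)
qed

definition circle_coord :: "real option \<Rightarrow> real" where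
  "circle_coord a = (case a of None \<Rightarrow> 0 | Some x \<Rightarrow> squash x)"

text \<open>The torus as the product of two circles \<open>\<real> \<union> {\<infinity>}\<close>, with \<open>None\<close> in the role of \<open>\<infinity>\<close>.\<close>

definition pt :: "real option \<Rightarrow> real option \<Rightarrow> (real \<times> real) set" where
  "pt a b = torus_proj (circle_coord a, circle_coord b)"

lemma circle_coord_bounds: "0 \<le> circle_coord a" "circle_coord a < 1"
  using squash_bounds by (auto simp: circle_coord_def less_imp_le split: option.splits)

lemma circle_coord_eq_iff: "circle_coord a - circle_coord b \<in> \<int> \<longleftrightarrow> a = b"
proof
  assume "circle_coord a - circle_coord b \<in> \<int>"
  then obtain n :: int where n: "circle_coord a - circle_coord b = n"
    by (auto elim: Ints_cases)
  have "- 1 < real_of_int n" "real_of_int n < 1"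
    using circle_coord_bounds[of a] circle_coord_bounds[of b] unfolding n[symmetric] by linarith+
  then have "n = 0" by linarith
  then have eq: "circle_coord a = circle_coord b"
    using n by simp
  show "a = b"
    using eq squash_bounds(1) by (auto simp: circle_coord_def squash_eq_iff split: option.splits)
       (metis less_irrefl)+
qed simp

lemma pt_eq_iff: "pt a b = pt a' b' \<longleftrightarrow> a = a' \<and> b = b'"
  by (simp add: pt_def torus_proj_eq_iff circle_coord_eq_iff)

lemma circle_coord_surj:
  assumes "u \<in> {0..<1}" obtains a where "u = circle_coord a"
proof (cases "u = 0")
  case True
  then have "u = circle_coord None" by (simp add: circle_coord_def)
  then show ?thesis by (rule that)
next
  case False
  then have "u = circle_coord (Some (tan (pi * (u - 1 / 2))))"
    using assms by (simp add: circle_coord_def squash_surj)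
  then show ?thesis by (rule that)
qed

lemma pt_cases:
  assumes "q \<in> topspace torus" obtains a b where "q = pt a b"
proof -
  obtain w where w: "q = torus_proj w" using assms by (auto simp: topspace_torus)
  obtain v where v: "torus_proj w = torus_proj v" "v \<in> {0..<1} \<times> {0..<1}"
    by (rule torus_proj_representative)
  obtain a where a: "fst v = circle_coord a" using v circle_coord_surj by (metis mem_Times_iff)
  obtain b where b: "snd v = circle_coord b" using v circle_coord_surj by (metis mem_Times_iff)
  have "q = pt a b"
    unfolding w v(1) pt_def a[symmetric] b[symmetric] by simp
  then show ?thesis by (rule that)
qed

lemma pt_in_torus: "pt a b \<in> topspace torus"
  by (auto simp: pt_def topspace_torus)

definition finite_pt :: "real \<times> real \<Rightarrow> (real \<times> real) set" where
  "finite_pt z = pt (Some (fst z)) (Some (snd z))"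

text \<open>The coordinate k = 1 / (x - y), with k = 0 read as y = \<infinity>. The cell covers the
  circle y = \<infinity> up to (\<infinity>, \<infinity>) and leaves out the circle x = \<infinity>
  and the diagonal, where k would be infinite.\<close>

definition slope_pt :: "real \<times> real \<Rightarrow> (real \<times> real) set" where
  "slope_pt z = pt (Some (fst z)) (if snd z = 0 then None else Some (fst z - 1 / snd z))"

definition slope_pt' :: "real \<times> real \<Rightarrow> (real \<times> real) set" where
  "slope_pt' z = pt (if snd z = 0 then None else Some (fst z - 1 / snd z)) (Some (fst z))"

lemma finite_pt_eq_iff: "finite_pt z = finite_pt w \<longleftrightarrow> z = w"
  by (simp add: finite_pt_def pt_eq_iff prod_eq_iff)

lemma slope_pt_slope_chart:
  assumes "snd z \<noteq> 0"
  shows "slope_pt z = finite_pt (slope_chart z)" "slope_pt' z = finite_pt (swap (slope_chart z))"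
  using assms by (simp_all add: slope_pt_def slope_pt'_def finite_pt_def slope_chart_def swap_def split_beta)

lemma finite_pt_embedding:
  "continuous_map plane torus finite_pt" "open_map plane torus finite_pt" "inj finite_pt"
proof -
  have *: "finite_pt = (\<lambda>z. torus_proj (squash (fst z), squash (snd z)))"
    by (auto simp: fun_eq_iff finite_pt_def pt_def circle_coord_def)
  show inj: "inj finite_pt"
    by (auto simp: inj_def finite_pt_eq_iff)
  have "continuous_on UNIV (\<lambda>z :: real \<times> real. (squash (fst z), squash (snd z)))"
    by (intro continuous_intros)
  then show "continuous_map plane torus finite_pt" "open_map plane torus finite_pt"
    unfolding * by (rule torus_embedding, use inj in \<open>simp add: *\<close>)+
qed

text \<open>A real lift of the circle coordinate of y: as k grows through 0, y runs to \<infinity>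
  and returns from -\<infinity>, and the added 1 on the side k > 0 joins the two branches at the
  value 1.\<close>

definition slope_lift :: "real \<times> real \<Rightarrow> real" where
  "slope_lift z = (if snd z = 0 then 1 else if snd z < 0 then squash (fst z - 1 / snd z)
     else 1 + squash (fst z - 1 / snd z))"

text \<open>Since arctan y = sgn y * \<pi> / 2 - arctan (1 / y), passing to 1 / y = k / (x * k - 1)
  turns both branches into one formula, which is regular at k = 0.\<close>

lemma slope_lift_near_0:
  assumes "fst z * snd z < 1"
  shows "slope_lift z = 1 - arctan (snd z / (fst z * snd z - 1)) / pi"
proof (cases "snd z = 0")
  case False
  define y where "y = fst z - 1 / snd z"
  have y: "y = (fst z * snd z - 1) / snd z" "1 / y = snd z / (fst z * snd z - 1)"
    using False by (simp_all add: y_def field_simps)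
  have "y \<noteq> 0" using y assms False by simp
  have at: "arctan (1 / y) = sgn y * pi / 2 - arctan y"
    using \<open>y \<noteq> 0\<close> by (rule Transcendental.arctan_inverse)
  show ?thesis
  proof (cases "snd z < 0")
    case True
    then have "y > 0" using assms by (simp add: y(1) divide_neg_neg)
    then show ?thesis
      using True False at unfolding y(2)[symmetric]
      by (simp add: slope_lift_def squash_def y_def[symmetric] diff_divide_distrib)
  next
    case F: False
    then have "y < 0" using assms False by (simp add: y(1) divide_neg_pos)
    then show ?thesis
      using F False at unfolding y(2)[symmetric]
      by (simp add: slope_lift_def squash_def y_def[symmetric] diff_divide_distrib)
  qed
qed (simp add: slope_lift_def)

lemma continuous_on_slope_lift: "continuous_on UNIV slope_lift"
proof -
  let ?N = "{z :: real \<times> real. fst z * snd z < 1}" and ?P = "{z :: real \<times> real. 0 < snd z}"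
    and ?M = "{z :: real \<times> real. snd z < 0}"
  have op: "open ?N" "open ?P" "open ?M"
    by (intro open_Collect_less continuous_intros)+
  have "continuous_on ?N (\<lambda>z. 1 - arctan (snd z / (fst z * snd z - 1)) / pi)"
    by (intro continuous_intros) auto
  then have N: "continuous_on ?N slope_lift"
    by (rule continuous_on_eq) (simp add: slope_lift_near_0)
  have "continuous_on ?P (\<lambda>z. 1 + squash (fst z - 1 / snd z))"
    by (intro continuous_intros) auto
  then have P: "continuous_on ?P slope_lift"
    by (rule continuous_on_eq) (simp add: slope_lift_def)
  have "continuous_on ?M (\<lambda>z. squash (fst z - 1 / snd z))"
    by (intro continuous_intros) auto
  then have M: "continuous_on ?M slope_lift"
    by (rule continuous_on_eq) (simp add: slope_lift_def)
  have "?N \<union> (?P \<union> ?M) = UNIV"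
    by auto (metis less_irrefl mult_zero_right zero_less_one not_less_iff_gr_or_eq)
  moreover have "continuous_on (?N \<union> (?P \<union> ?M)) slope_lift"
    by (intro continuous_on_open_Un open_Un op N P M)
  ultimately show ?thesis by simp
qed

lemma slope_pt_eq: "slope_pt z = torus_proj (squash (fst z), slope_lift z)"
  and slope_pt'_eq: "slope_pt' z = torus_proj (slope_lift z, squash (fst z))"
  by (auto simp: slope_pt_def slope_pt'_def pt_def circle_coord_def slope_lift_def torus_proj_eq_iff)

lemma slope_pt_embedding:
  "continuous_map plane torus slope_pt" "open_map plane torus slope_pt" "inj slope_pt"
  "continuous_map plane torus slope_pt'" "open_map plane torus slope_pt'" "inj slope_pt'"
proof -
  show inj: "inj slope_pt" "inj slope_pt'"
    by (auto simp: inj_def slope_pt_def slope_pt'_def pt_eq_iff prod_eq_iff split: if_splits)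
  have "continuous_on UNIV (\<lambda>z. (squash (fst z), slope_lift z))"
    by (intro continuous_intros continuous_on_slope_lift)
  then show "continuous_map plane torus slope_pt" "open_map plane torus slope_pt"
    unfolding slope_pt_eq[abs_def] by (rule torus_embedding, use inj in \<open>simp add: slope_pt_eq[abs_def]\<close>)+
  have "continuous_on UNIV (\<lambda>z. (slope_lift z, squash (fst z)))"
    by (intro continuous_intros continuous_on_slope_lift)
  then show "continuous_map plane torus slope_pt'" "open_map plane torus slope_pt'"
    unfolding slope_pt'_eq[abs_def] by (rule torus_embedding, use inj in \<open>simp add: slope_pt'_eq[abs_def]\<close>)+
qed

lemma range_slope_pt: "range slope_pt = {pt (Some x) b |x b. b \<noteq> Some x}"
proof (intro set_eqI iffI)
  fix q assume "q \<in> {pt (Some x) b |x b. b \<noteq> Some x}"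
  then obtain x b where q: "q = pt (Some x) b" "b \<noteq> Some x" by blast
  show "q \<in> range slope_pt"
  proof (cases b)
    case None
    then have "q = slope_pt (x, 0)" using q by (simp add: slope_pt_def)
    then show ?thesis by blast
  next
    case (Some y)
    then have "q = slope_pt (x, 1 / (x - y))" using q by (simp add: slope_pt_def)
    then show ?thesis by blast
  qed
qed (auto simp: slope_pt_def pt_eq_iff)

lemma range_slope_pt': "range slope_pt' = {pt a (Some y) |a y. a \<noteq> Some y}"
proof (intro set_eqI iffI)
  fix q assume "q \<in> {pt a (Some y) |a y. a \<noteq> Some y}"
  then obtain a y where q: "q = pt a (Some y)" "a \<noteq> Some y" by blast
  show "q \<in> range slope_pt'"
  proof (cases a)
    case None
    then have "q = slope_pt' (y, 0)" using q by (simp add: slope_pt'_def)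
    then show ?thesis by blast
  next
    case (Some x)
    then have "q = slope_pt' (y, 1 / (y - x))" using q by (simp add: slope_pt'_def)
    then show ?thesis by blast
  qed
qed (auto simp: slope_pt'_def pt_eq_iff)

lemma range_finite_pt: "range finite_pt = {pt (Some x) (Some y) |x y. True}"
proof (intro set_eqI iffI)
  fix q assume "q \<in> {pt (Some x) (Some y) |x y. True}"
  then obtain x y where "q = finite_pt (x, y)"
    by (auto simp: finite_pt_def)
  then show "q \<in> range finite_pt" by blast
qed (auto simp: finite_pt_def)

section \<open>The extended flow\<close>

text \<open>Points are cosets, so their circle coordinates are recovered by choice; they are unique.
  On both circles at infinity every extension is the unit translation, and (\<infinity>,
  \<infinity>) is fixed because \<open>None\<close> is.\<close>

definition torus_flow :: "(real \<Rightarrow> real \<times> real \<Rightarrow> real \<times> real) \<Rightarrow> real \<Rightarrow> (real \<times> real) set \<Rightarrow> (real \<times> real) set" where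
  "torus_flow F t q = (case (SOME ab. q = pt (fst ab) (snd ab)) of
      (Some x, Some y) \<Rightarrow> finite_pt (F t (x, y))
    | (a, b) \<Rightarrow> pt (map_option ((+) t) a) (map_option ((+) t) b))"

lemma torus_flow_pt:
  "torus_flow F t (pt a b) = (case (a, b) of (Some x, Some y) \<Rightarrow> finite_pt (F t (x, y))
    | (a, b) \<Rightarrow> pt (map_option ((+) t) a) (map_option ((+) t) b))"
proof -
  have "(SOME ab. pt a b = pt (fst ab) (snd ab)) = (a, b)"
    by (rule some_equality) (auto simp: pt_eq_iff prod_eq_iff)
  then show ?thesis
    by (simp add: torus_flow_def)
qed

lemma torus_flow_finite_pt: "torus_flow F t (finite_pt z) = finite_pt (F t z)"
  by (simp add: finite_pt_def torus_flow_pt)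

lemma torus_flow_infinity:
  "torus_flow F t (pt None None) = pt None None"
  "torus_flow F t (pt (Some x) None) = pt (Some (x + t)) None"
  "torus_flow F t (pt None (Some x)) = pt None (Some (x + t))"
  by (simp_all add: torus_flow_pt add.commute)

lemma limitin_torus_proj:
  assumes "(f \<longlongrightarrow> i) F" "(g \<longlongrightarrow> j) F" "i \<in> \<int>" "j \<in> \<int>"
  shows "limitin torus (\<lambda>t. torus_proj (f t, g t)) (pt None None) F"
proof -
  have "limitin plane (\<lambda>t. (f t, g t)) (i, j) F"
    using assms by (simp add: tendsto_Pair)
  then have "limitin torus (torus_proj \<circ> (\<lambda>t. (f t, g t))) (torus_proj (i, j)) F"
    by (rule continuous_map_limit[OF continuous_map_torus_proj])
  moreover have "torus_proj (i, j) = pt None None"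
    using assms by (simp add: pt_def torus_proj_eq_iff circle_coord_def)
  ultimately show ?thesis
    by (simp add: o_def)
qed

text \<open>The limits 1 and 0 of \<open>squash\<close> are both integers, so the two ways to escape
  lead to the same point.\<close>

lemma limitin_finite_pt:
  assumes "escapes f F"
  shows "limitin torus (\<lambda>t. finite_pt (f t)) (pt None None) F"
proof -
  have "limitin torus (\<lambda>t. torus_proj (squash (fst (f t)), squash (snd (f t)))) (pt None None) F"
    using assms unfolding escapes_def
  proof
    assume "filterlim (\<lambda>t. fst (f t)) at_top F \<and> filterlim (\<lambda>t. snd (f t)) at_top F"
    then show ?thesis
      using filterlim_compose[OF squash_at_top] by (intro limitin_torus_proj[of _ 1 _ _ 1]) auto
  next
    assume "filterlim (\<lambda>t. fst (f t)) at_bot F \<and> filterlim (\<lambda>t. snd (f t)) at_bot F"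
    then show ?thesis
      using filterlim_compose[OF squash_at_bot] by (intro limitin_torus_proj[of _ 0 _ _ 0]) auto
  qed
  then show ?thesis
    by (simp add: finite_pt_def pt_def circle_coord_def)
qed

lemma limitin_infinite_pt:
  "limitin torus (\<lambda>t. pt (Some (x + t)) None) (pt None None) at_top"
  "limitin torus (\<lambda>t. pt (Some (x + t)) None) (pt None None) at_bot"
  "limitin torus (\<lambda>t. pt None (Some (x + t))) (pt None None) at_top"
  "limitin torus (\<lambda>t. pt None (Some (x + t))) (pt None None) at_bot"
proof -
  have "filterlim (\<lambda>t. x + t) at_top at_top" "filterlim (\<lambda>t. x + t) at_bot at_bot"
    by real_asymp+
  then have l: "((\<lambda>t. squash (x + t)) \<longlongrightarrow> 1) at_top" "((\<lambda>t. squash (x + t)) \<longlongrightarrow> 0) at_bot"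
    using filterlim_compose[OF squash_at_top] filterlim_compose[OF squash_at_bot] by blast+
  show "limitin torus (\<lambda>t. pt (Some (x + t)) None) (pt None None) at_top"
  "limitin torus (\<lambda>t. pt (Some (x + t)) None) (pt None None) at_bot"
  "limitin torus (\<lambda>t. pt None (Some (x + t))) (pt None None) at_top"
  "limitin torus (\<lambda>t. pt None (Some (x + t))) (pt None None) at_bot"
    using limitin_torus_proj[OF l(1) tendsto_const[of 0]] limitin_torus_proj[OF l(2) tendsto_const[of 0]]
      limitin_torus_proj[OF tendsto_const[of 0] l(1)] limitin_torus_proj[OF tendsto_const[of 0] l(2)]
    by (simp_all add: pt_def circle_coord_def)
qed

section \<open>Extending plane flows to the torus\<close>

lemma closure_snd_pos: "z \<in> closure {w :: real \<times> real. 0 < snd w}" if "snd z = 0"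
proof -
  have "{w :: real \<times> real. 0 < snd w} = UNIV \<times> {0<..}"
    by auto
  then show ?thesis
    using that by (simp add: closure_Times mem_Times_iff)
qed

text \<open>The side k > 0 of the slope cells consists of finite points off the diagonal and has k =
  0 in its closure.\<close>

lemma infinite_orbits_in_closure:
  "pt (Some x) None \<in> torus closure_of (finite_pt ` {z. fst z - snd z \<noteq> 0})"
  "pt None (Some x) \<in> torus closure_of (finite_pt ` {z. fst z - snd z \<noteq> 0})"
proof -
  let ?S = "finite_pt ` {z. fst z - snd z \<noteq> 0}"
  have sub: "slope_pt ` {w. 0 < snd w} \<subseteq> ?S" "slope_pt' ` {w. 0 < snd w} \<subseteq> ?S"
  proof -
    show "slope_pt ` {w. 0 < snd w} \<subseteq> ?S"
      by (auto simp: slope_pt_slope_chart slope_chart_def intro!: imageI)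
    show "slope_pt' ` {w. 0 < snd w} \<subseteq> ?S"
      by (auto simp: slope_pt_slope_chart slope_chart_def swap_def intro!: imageI)
  qed
  have "slope_pt (x, 0) \<in> torus closure_of ?S"
    by (rule continuous_map_in_closure_of[OF slope_pt_embedding(1) sub(1) closure_snd_pos]) simp
  then show "pt (Some x) None \<in> torus closure_of ?S"
    by (simp add: slope_pt_def)
  have "slope_pt' (x, 0) \<in> torus closure_of ?S"
    by (rule continuous_map_in_closure_of[OF slope_pt_embedding(4) sub(2) closure_snd_pos]) simp
  then show "pt None (Some x) \<in> torus closure_of ?S"
    by (simp add: slope_pt'_def)
qed

lemma finite_in_closure_of_band:
  assumes "lo < hi" "fst z - snd z = lo \<or> fst z - snd z = hi"
  shows "finite_pt z \<in> torus closure_of (finite_pt ` {z. lo < fst z - snd z \<and> fst z - snd z < hi})"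
proof (rule continuous_map_in_closure_of[OF finite_pt_embedding(1) subset_refl])
  have "z \<in> plane frontier_of {z. lo < fst z - snd z \<and> fst z - snd z < hi}"
    using assms(2) unfolding frontier_band[OF assms(1)] by auto
  then show "z \<in> closure {z. lo < fst z - snd z \<and> fst z - snd z < hi}"
    by (simp add: frontier_def)
qed

lemma off_diagonal_subset:
  "finite_pt ` {z. fst z - snd z \<noteq> 0} \<subseteq> range slope_pt" "finite_pt ` {z. fst z - snd z \<noteq> 0} \<subseteq> range slope_pt'"
  by (auto simp: range_slope_pt range_slope_pt' finite_pt_def pt_eq_iff)

lemma diagonal_in_closure:
  assumes "fst z - snd z = 0"
  shows "finite_pt z \<in> torus closure_of (finite_pt ` {z. fst z - snd z \<noteq> 0})"
proof -
  have "finite_pt ` {z. 0 < fst z - snd z \<and> fst z - snd z < 1} \<subseteq> finite_pt ` {z. fst z - snd z \<noteq> 0}"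
    by auto
  from closure_of_mono[OF this] show ?thesis
    using finite_in_closure_of_band[of 0 1 z] assms by auto
qed

text \<open>\<open>\<theta>\<close> turns the horizontal flow into \<open>F\<close>, written in the coordinates of \<^const>\<open>slope_chart\<close>.\<close>

locale toral_extension =
  fixes F :: "real \<Rightarrow> real \<times> real \<Rightarrow> real \<times> real" and \<theta> :: "real \<times> real \<Rightarrow> real \<times> real"
  assumes charts: "\<exists>e. flow_chart plane F e \<and> z \<in> range e"
    and escapes: "escapes (\<lambda>t. F t z) at_top" "escapes (\<lambda>t. F t z) at_bot"
    and swap: "F t (swap z) = swap (F t z)"
    and \<theta>: "continuous_on UNIV \<theta>" "inj \<theta>" "range \<theta> = UNIV"
    and \<theta>_0: "\<theta> (T, 0) = (T, 0)"
    and \<theta>_nonzero: "J \<noteq> 0 \<Longrightarrow> snd (\<theta> (T, J)) \<noteq> 0"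
    and \<theta>_slope: "J \<noteq> 0 \<Longrightarrow> F t (slope_chart (\<theta> (T, J))) = slope_chart (\<theta> (T + t, J))"
    and orbit_diagonal: "orbit F (sc 0 0) = {z. fst z - snd z = 0}"
begin

lemma flow_chart_finite:
  assumes "flow_chart plane F e" shows "flow_chart torus (torus_flow F) (finite_pt \<circ> e)"
  using assms by (intro flow_chart_compose finite_pt_embedding) (auto simp: flow_chart_def torus_flow_finite_pt)

text \<open>Points at infinity and finite points are two cases of the conjugacy only; \<theta> is
  one continuous map across k = 0, where it is the identity, and this makes the extended flow
  continuous there.\<close>

lemma flow_chart_slope: "flow_chart torus (torus_flow F) (slope_pt \<circ> \<theta>)"
proof (intro flow_chart_compose slope_pt_embedding \<theta>)
  fix t and z :: "real \<times> real"
  obtain T J where z: "z = (T, J)" by (cases z)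
  show "torus_flow F t (slope_pt (\<theta> z)) = slope_pt (\<theta> (strip_flow t z))"
  proof (cases "J = 0")
    case True
    then show ?thesis
      by (simp add: z \<theta>_0 strip_flow_def slope_pt_def torus_flow_infinity)
  next
    case False
    then show ?thesis
      by (simp add: z \<theta>_nonzero strip_flow_def slope_pt_slope_chart torus_flow_finite_pt \<theta>_slope)
  qed
qed

lemma flow_chart_slope': "flow_chart torus (torus_flow F) (slope_pt' \<circ> \<theta>)"
proof (intro flow_chart_compose slope_pt_embedding \<theta>)
  fix t and z :: "real \<times> real"
  obtain T J where z: "z = (T, J)" by (cases z)
  show "torus_flow F t (slope_pt' (\<theta> z)) = slope_pt' (\<theta> (strip_flow t z))"
  proof (cases "J = 0")
    case True
    then show ?thesis
      by (simp add: z \<theta>_0 strip_flow_def slope_pt'_def torus_flow_infinity)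
  next
    case False
    then show ?thesis
      by (simp add: z \<theta>_nonzero strip_flow_def slope_pt_slope_chart torus_flow_finite_pt \<theta>_slope swap)
  qed
qed

lemma range_slope: "range (slope_pt \<circ> \<theta>) = range slope_pt" "range (slope_pt' \<circ> \<theta>) = range slope_pt'"
  using \<theta>(3) by (metis image_comp)+

lemma torus_charts:
  assumes "q \<in> topspace torus - {pt None None}"
  shows "\<exists>e. flow_chart torus (torus_flow F) e \<and> q \<in> range e \<and> pt None None \<notin> range e"
proof -
  obtain a b where q: "q = pt a b" using assms pt_cases by blast
  have not_in: "pt None None \<notin> range finite_pt" "pt None None \<notin> range slope_pt" "pt None None \<notin> range slope_pt'"
    by (auto simp: range_finite_pt range_slope_pt range_slope_pt' pt_eq_iff)
  consider x y where "a = Some x" "b = Some y" | x where "a = Some x" "b = None" | y where "a = None" "b = Some y"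
    using assms q by (cases a; cases b) auto
  then show ?thesis
  proof cases
    case 1
    then have qz: "q = finite_pt (x, y)" by (simp add: q finite_pt_def)
    obtain e where e: "flow_chart plane F e" "(x, y) \<in> range e" using charts by blast
    have "q \<in> range (finite_pt \<circ> e)"
      using e(2) qz by auto
    moreover have "pt None None \<notin> range (finite_pt \<circ> e)"
      using not_in(1) by auto
    ultimately show ?thesis
      using flow_chart_finite[OF e(1)] by blast
  next
    case 2
    then have "q \<in> range (slope_pt \<circ> \<theta>)"
      unfolding range_slope range_slope_pt q by blast
    then show ?thesis
      using flow_chart_slope not_in(2) range_slope(1) by metis
  next
    case 3
    then have "q \<in> range (slope_pt' \<circ> \<theta>)"
      unfolding range_slope range_slope_pt' q by blast
    then show ?thesis
      using flow_chart_slope' not_in(3) range_slope(2) by metis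
  qed
qed

lemma is_flow_torus: "is_flow torus (torus_flow F)"
  by (intro is_flow_of_charts_fixed_point[where p = "pt None None"] Hausdorff_space_torus compact_space_torus
      pt_in_torus torus_flow_infinity torus_charts)

lemma limits:
  assumes "q \<in> topspace torus - {pt None None}"
  shows "limitin torus (\<lambda>t. torus_flow F t q) (pt None None) at_top"
    "limitin torus (\<lambda>t. torus_flow F t q) (pt None None) at_bot"
proof -
  obtain a b where q: "q = pt a b" using assms pt_cases by blast
  consider x y where "a = Some x" "b = Some y" | x where "a = Some x" "b = None" | y where "a = None" "b = Some y"
    using assms q by (cases a; cases b) auto
  then have "limitin torus (\<lambda>t. torus_flow F t q) (pt None None) at_top \<and>
    limitin torus (\<lambda>t. torus_flow F t q) (pt None None) at_bot"
  proof cases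
    case 1
    then have "q = finite_pt (x, y)" by (simp add: q finite_pt_def)
    then show ?thesis
      by (simp add: torus_flow_finite_pt limitin_finite_pt escapes)
  next
    case 2
    then show ?thesis by (simp add: q torus_flow_infinity limitin_infinite_pt)
  next
    case 3
    then show ?thesis by (simp add: q torus_flow_infinity limitin_infinite_pt)
  qed
  then show "limitin torus (\<lambda>t. torus_flow F t q) (pt None None) at_top"
    "limitin torus (\<lambda>t. torus_flow F t q) (pt None None) at_bot"
    by auto
qed

lemma torus_flow_away:
  assumes "q \<in> topspace torus - {pt None None}"
  shows "torus_flow F t q \<in> topspace torus - {pt None None}"
proof -
  obtain e where "flow_chart torus (torus_flow F) e" "q \<in> range e" "pt None None \<notin> range e"
    using torus_charts[OF assms] by blast
  then show ?thesis
    using flow_law_flow_chart(3)[of torus "torus_flow F" e q t] flow_chart_mem[of torus "torus_flow F" e] by auto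
qed

lemma limit_sets:
  assumes "q \<in> topspace torus - {pt None None}"
  shows "alpha' torus (torus_flow F) q = {pt None None}" "omega' torus (torus_flow F) q = {pt None None}"
proof -
  have "pt None None \<notin> orbit (torus_flow F) q"
    using torus_flow_away[OF assms] by (auto simp: orbit_def)
  moreover have "alpha_limit torus (torus_flow F) q = {pt None None}"
    by (rule alpha_limit_eq_singleton[OF Hausdorff_space_torus]) (rule limits[OF assms])
  moreover have "omega_limit torus (torus_flow F) q = {pt None None}"
    by (rule omega_limit_eq_singleton[OF Hausdorff_space_torus]) (rule limits[OF assms])
  ultimately show "alpha' torus (torus_flow F) q = {pt None None}" "omega' torus (torus_flow F) q = {pt None None}"
    by (auto simp: alpha'_def omega'_def)
qed

lemma not_fixed:
  assumes "q \<in> topspace torus - {pt None None}"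
  shows "\<exists>t. torus_flow F t q \<noteq> q"
proof (rule ccontr)
  assume "\<nexists>t. torus_flow F t q \<noteq> q"
  then have "torus_flow F t q = q" for t
    by blast
  then have "limitin torus (\<lambda>t :: real. q) (pt None None) at_top"
    using limits(1)[OF assms] by simp
  moreover have "limitin torus (\<lambda>t :: real. q) q at_top"
    using assms by simp
  ultimately show False
    using limitin_Hausdorff_unique[OF _ _ _ Hausdorff_space_torus] assms trivial_limit_at_top_linorder by blast
qed

lemma singular_points_torus: "singular_points torus (torus_flow F) = {pt None None}"
proof
  show "singular_points torus (torus_flow F) \<subseteq> {pt None None}"
  proof
    fix q assume "q \<in> singular_points torus (torus_flow F)"
    then have "q \<in> topspace torus" "torus_flow F t q = q" for t
      by (auto simp: singular_points_def orbit_def)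
    then show "q \<in> {pt None None}"
      using not_fixed[of q] by blast
  qed
  show "{pt None None} \<subseteq> singular_points torus (torus_flow F)"
    by (auto simp: singular_points_def pt_in_torus orbit_def torus_flow_infinity)
qed

lemma ordinary_torus:
  assumes e: "flow_chart torus (torus_flow F) e" "q \<in> range e" "pt None None \<notin> range e"
    and ab: "a \<in> topspace torus - {pt None None}" "b \<in> topspace torus - {pt None None}"
    and ne: "orbit (torus_flow F) a \<noteq> orbit (torus_flow F) b"
    and fr: "torus frontier_of range e = {pt None None} \<union> orbit (torus_flow F) a \<union> orbit (torus_flow F) b"
  shows "ordinary torus (torus_flow F) q"
proof (rule ordinary_flow_chart[OF e(1,2) _ _ ne _ fr])
  show "a \<in> topspace torus" "b \<in> topspace torus"
    using ab by auto
  show "alpha' torus (torus_flow F) u = {pt None None} \<and> omega' torus (torus_flow F) u = {pt None None}"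
    if "u \<in> range e \<union> {a, b}" for u
  proof -
    have "u \<in> topspace torus - {pt None None}"
      using that ab flow_chart_mem[OF e(1)] e(3) by auto
    then show ?thesis
      using limit_sets by blast
  qed
  show "(orbit (torus_flow F) a \<union> orbit (torus_flow F) b) \<inter> {pt None None} = {}"
    using torus_flow_away ab by (auto simp: orbit_def)
qed

text \<open>The range is invariant and contains an orbit that converges to (\<infinity>,
  \<infinity>).\<close>

lemma infinity_in_closure:
  assumes "flow_chart torus (torus_flow F) e" "pt None None \<notin> range e"
  shows "pt None None \<in> torus closure_of range e"
proof (rule limitin_imp_in_closure_of)
  have "e (0, 0) \<in> topspace torus - {pt None None}"
    using assms flow_chart_mem[OF assms(1)] by auto
  then show "limitin torus (\<lambda>t. torus_flow F t (e (0, 0))) (pt None None) at_top"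
    by (rule limits)
  show "torus_flow F t (e (0, 0)) \<in> range e" for t
    using assms(1) by (auto simp: flow_chart_flow)
  show "range e \<subseteq> topspace torus"
    using flow_chart_mem[OF assms(1)] by auto
qed simp

lemma orbit_infinite:
  "orbit (torus_flow F) (pt (Some x) None) = range (\<lambda>x. pt (Some x) None)"
  "orbit (torus_flow F) (pt None (Some x)) = range (\<lambda>x. pt None (Some x))"
proof -
  have s: "range (\<lambda>t. g (x + t)) = range g" for g :: "real \<Rightarrow> (real \<times> real) set"
  proof
    show "range g \<subseteq> range (\<lambda>t. g (x + t))"
    proof
      fix q assume "q \<in> range g"
      then obtain u where "q = g (x + (u - x))" by auto
      then show "q \<in> range (\<lambda>t. g (x + t))" by blast
    qed
  qed auto
  show "orbit (torus_flow F) (pt (Some x) None) = range (\<lambda>x. pt (Some x) None)"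
    "orbit (torus_flow F) (pt None (Some x)) = range (\<lambda>x. pt None (Some x))"
    unfolding orbit_def torus_flow_infinity by (rule s)+
qed

lemma orbit_finite: "orbit (torus_flow F) (finite_pt z) = finite_pt ` orbit F z"
  by (auto simp: orbit_def torus_flow_finite_pt)

section \<open>Ordinary orbits on the torus\<close>

text \<open>The slope cells are dense: the rest of the torus is the fixed point, one circle at
  infinity and the diagonal. The latter two, without the fixed point, are single orbits, so each
  cell has exactly two boundary orbits.\<close>

lemma frontier_slope:
  "torus frontier_of range slope_pt =
     {pt None None} \<union> orbit (torus_flow F) (pt None (Some 0)) \<union> orbit (torus_flow F) (finite_pt (sc 0 0))"
  "torus frontier_of range slope_pt' =
     {pt None None} \<union> orbit (torus_flow F) (pt (Some 0) None) \<union> orbit (torus_flow F) (finite_pt (sc 0 0))"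
proof -
  have diag: "orbit (torus_flow F) (finite_pt (sc 0 0)) = {pt (Some x) (Some x) |x. True}"
  proof -
    have e: "{z :: real \<times> real. fst z - snd z = 0} = range (\<lambda>x. (x, x))"
      by (force simp: image_iff)
    show ?thesis
      unfolding orbit_finite orbit_diagonal e image_image by (auto simp: finite_pt_def)
  qed
  have diag_cl: "orbit (torus_flow F) (finite_pt (sc 0 0)) \<subseteq> torus closure_of (finite_pt ` {z. fst z - snd z \<noteq> 0})"
    unfolding orbit_finite orbit_diagonal using diagonal_in_closure by auto
  have p: "pt None None \<notin> range slope_pt" "pt None None \<notin> range slope_pt'"
    by (auto simp: range_slope_pt range_slope_pt' pt_eq_iff)
  have p_cl: "pt None None \<in> torus closure_of range slope_pt" "pt None None \<in> torus closure_of range slope_pt'"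
    using infinity_in_closure[OF flow_chart_slope] infinity_in_closure[OF flow_chart_slope'] p
    unfolding range_slope by auto
  show "torus frontier_of range slope_pt =
     {pt None None} \<union> orbit (torus_flow F) (pt None (Some 0)) \<union> orbit (torus_flow F) (finite_pt (sc 0 0))"
  proof (rule frontier_of_eqI)
    show "openin torus (range slope_pt)"
      using flow_chart_open[OF flow_chart_slope open_UNIV] range_slope by simp
    show "range slope_pt \<inter> ({pt None None} \<union> orbit (torus_flow F) (pt None (Some 0)) \<union> orbit (torus_flow F) (finite_pt (sc 0 0))) = {}"
      unfolding range_slope_pt orbit_infinite diag by (auto simp: pt_eq_iff)
    have "topspace torus - (range slope_pt \<union> ({pt None None} \<union> orbit (torus_flow F) (pt None (Some 0)) \<union>
      orbit (torus_flow F) (finite_pt (sc 0 0)))) = {}"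
    proof -
      have "pt a b \<in> range slope_pt \<union> ({pt None None} \<union> orbit (torus_flow F) (pt None (Some 0)) \<union>
        orbit (torus_flow F) (finite_pt (sc 0 0)))" for a b
        unfolding range_slope_pt orbit_infinite diag by (cases a; cases b) (auto simp: pt_eq_iff)
      then show ?thesis
        by (metis (no_types, lifting) Diff_eq_empty_iff pt_cases subsetI)
    qed
    then show "openin torus (topspace torus - (range slope_pt \<union> ({pt None None} \<union> orbit (torus_flow F) (pt None (Some 0)) \<union>
      orbit (torus_flow F) (finite_pt (sc 0 0)))))"
      by (metis openin_empty)
    show "{pt None None} \<union> orbit (torus_flow F) (pt None (Some 0)) \<union> orbit (torus_flow F) (finite_pt (sc 0 0)) \<subseteq> torus closure_of range slope_pt"
      using p_cl(1) diag_cl infinite_orbits_in_closure(2) closure_of_mono[OF off_diagonal_subset(1)]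
      unfolding orbit_infinite by blast
  qed
  show "torus frontier_of range slope_pt' =
     {pt None None} \<union> orbit (torus_flow F) (pt (Some 0) None) \<union> orbit (torus_flow F) (finite_pt (sc 0 0))"
  proof (rule frontier_of_eqI)
    show "openin torus (range slope_pt')"
      using flow_chart_open[OF flow_chart_slope' open_UNIV] range_slope by simp
    show "range slope_pt' \<inter> ({pt None None} \<union> orbit (torus_flow F) (pt (Some 0) None) \<union> orbit (torus_flow F) (finite_pt (sc 0 0))) = {}"
      unfolding range_slope_pt' orbit_infinite diag by (auto simp: pt_eq_iff)
    have "topspace torus - (range slope_pt' \<union> ({pt None None} \<union> orbit (torus_flow F) (pt (Some 0) None) \<union>
      orbit (torus_flow F) (finite_pt (sc 0 0)))) = {}"
    proof -
      have "pt a b \<in> range slope_pt' \<union> ({pt None None} \<union> orbit (torus_flow F) (pt (Some 0) None) \<union>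
        orbit (torus_flow F) (finite_pt (sc 0 0)))" for a b
        unfolding range_slope_pt' orbit_infinite diag by (cases a; cases b) (auto simp: pt_eq_iff)
      then show ?thesis
        by (metis (no_types, lifting) Diff_eq_empty_iff pt_cases subsetI)
    qed
    then show "openin torus (topspace torus - (range slope_pt' \<union> ({pt None None} \<union> orbit (torus_flow F) (pt (Some 0) None) \<union>
      orbit (torus_flow F) (finite_pt (sc 0 0)))))"
      by (metis openin_empty)
    show "{pt None None} \<union> orbit (torus_flow F) (pt (Some 0) None) \<union> orbit (torus_flow F) (finite_pt (sc 0 0)) \<subseteq> torus closure_of range slope_pt'"
      using p_cl(2) diag_cl infinite_orbits_in_closure(1) closure_of_mono[OF off_diagonal_subset(2)]
      unfolding orbit_infinite by blast
  qed
qed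

lemma ordinary_slope:
  assumes "q \<in> range slope_pt \<union> range slope_pt'"
  shows "ordinary torus (torus_flow F) q"
proof -
  have ne: "orbit (torus_flow F) (pt None (Some 0)) \<noteq> orbit (torus_flow F) (finite_pt (sc 0 0))"
    "orbit (torus_flow F) (pt (Some 0) None) \<noteq> orbit (torus_flow F) (finite_pt (sc 0 0))"
  proof -
    have "pt None (Some 0) \<notin> orbit (torus_flow F) (finite_pt (sc 0 0))"
      "pt (Some 0) None \<notin> orbit (torus_flow F) (finite_pt (sc 0 0))"
      unfolding orbit_finite by (auto simp: finite_pt_def pt_eq_iff)
    then show "orbit (torus_flow F) (pt None (Some 0)) \<noteq> orbit (torus_flow F) (finite_pt (sc 0 0))"
      "orbit (torus_flow F) (pt (Some 0) None) \<noteq> orbit (torus_flow F) (finite_pt (sc 0 0))"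
      unfolding orbit_infinite by auto
  qed
  have mem: "pt None (Some 0) \<in> topspace torus - {pt None None}" "pt (Some 0) None \<in> topspace torus - {pt None None}"
    "finite_pt (sc 0 0) \<in> topspace torus - {pt None None}"
    by (auto simp: pt_in_torus finite_pt_def pt_eq_iff)
  have p: "pt None None \<notin> range (slope_pt \<circ> \<theta>)" "pt None None \<notin> range (slope_pt' \<circ> \<theta>)"
    unfolding range_slope by (auto simp: range_slope_pt range_slope_pt' pt_eq_iff)
  show ?thesis
    using assms
  proof
    assume "q \<in> range slope_pt"
    then show ?thesis
      using frontier_slope(1) range_slope(1) ne(1) mem p by (intro ordinary_torus[OF flow_chart_slope]) auto
  next
    assume "q \<in> range slope_pt'"
    then show ?thesis
      using frontier_slope(2) range_slope(2) ne(2) mem p by (intro ordinary_torus[OF flow_chart_slope']) auto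
  qed
qed

text \<open>The two slope cells contain all regular points except the finite diagonal. Its points
  call for a region that depends on the flow, hence the premise.\<close>

lemma separatrix_set_torus:
  assumes "\<And>z. fst z = snd z \<Longrightarrow> ordinary torus (torus_flow F) (finite_pt z)"
  shows "separatrix_set torus (torus_flow F) = {pt None None}"
proof -
  have "\<not> ordinary torus (torus_flow F) (pt None None)"
  proof (rule not_ordinary_fixed_point[OF Hausdorff_space_torus pt_in_torus])
    show "pt None (Some 0) \<in> topspace torus - {pt None None}"
      by (auto simp: pt_in_torus pt_eq_iff)
  qed (use torus_flow_infinity torus_flow_away limits in blast)+
  moreover have "ordinary torus (torus_flow F) q" if q_away: "q \<in> topspace torus - {pt None None}" for q
  proof -
    obtain a b where q: "q = pt a b" using q_away pt_cases by blast
    consider x where "a = Some x" "b = Some x" | "q \<in> range slope_pt \<union> range slope_pt'"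
      using q_away unfolding q range_slope_pt range_slope_pt' by (cases a; cases b) (auto simp: pt_eq_iff)
    then show ?thesis
    proof cases
      case 1
      then have "q = finite_pt (x, x)" by (simp add: q finite_pt_def)
      then show ?thesis using assms by simp
    qed (rule ordinary_slope)
  qed
  ultimately show ?thesis
    by (auto simp: separatrix_set_def pt_in_torus)
qed

end

text \<open>The translation keeps k constant, so the coordinates (x, k) are already straight and the
  identity serves as \<theta>.\<close>

interpretation diag: toral_extension diag_flow "\<lambda>z. z"
proof
  show "\<exists>e. flow_chart plane diag_flow e \<and> z \<in> range e" for z
  proof -
    have "z \<in> range (slab_chart (fst z - snd z))"
      by (simp add: range_slab_chart)
    then show ?thesis
      using flow_chart_slab by blast
  qed
  show "diag_flow t (swap z) = swap (diag_flow t z)" for t z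
    by (simp add: diag_flow_def swap_def split_beta)
  show "diag_flow t (slope_chart (T, J)) = slope_chart (T + t, J)" for t T J
    by (simp add: diag_flow_def slope_chart_def)
  show "orbit diag_flow (sc 0 0) = {z. fst z - snd z = 0}"
    unfolding orbit_diag_flow diff_sc ..
qed (auto simp: escapes_diag_flow)

interpretation reeb: toral_extension reeb_flow straighten
proof
  show "straighten (T, 0) = (T, 0)" for T
    by (simp add: straighten_inner)
  show "snd (straighten (T, J)) \<noteq> 0" if "J \<noteq> 0" for T J
    using that snd_straighten_eq_0_iff by blast
  show "orbit reeb_flow (sc 0 0) = {z. fst z - snd z = 0}"
    using orbit_reeb_flow[of "sc 0 0"] by (simp add: fst_sc snd_sc)
qed (auto simp: escapes_reeb_flow reeb_flow_charts reeb_flow_swap reeb_flow_slope straighten_inner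
      continuous_on_straighten inj_straighten range_straighten)

section \<open>The torus\<close>

text \<open>The translation preserves c, and |k| = 1 / |c| on the slope cells. Finite orbits are
  separated by a value of c between them, a finite orbit and a circle at infinity by |c| < M and |k|
  < 1 / M. The fixed point is excluded, as every orbit tends to it.\<close>

lemma separated_diag_flow:
  assumes W: "W \<in> topspace torus - {pt None None}"
    and orb: "W \<notin> orbit (torus_flow diag_flow) (finite_pt z)"
  shows "\<not> prolongs torus (torus_flow diag_flow) (finite_pt z) W \<and>
    \<not> prolongs torus (torus_flow diag_flow) W (finite_pt z)"
proof -
  let ?c = "\<lambda>z :: real \<times> real. fst z - snd z" and ?\<Phi> = "torus_flow diag_flow"
  have sep: ?thesis if "openin torus U" "finite_pt z \<in> U" "openin torus V" "W \<in> V" "U \<inter> V = {}"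
      "\<And>t q. q \<in> U \<Longrightarrow> ?\<Phi> t q \<in> U" "\<And>t q. q \<in> V \<Longrightarrow> ?\<Phi> t q \<in> V" for U V
    using not_prolongs[of torus U "finite_pt z" V W ?\<Phi>] not_prolongs[of torus V W U "finite_pt z" ?\<Phi>] that
    by (simp add: Int_commute)
  have finite_open: "openin torus (finite_pt ` A)" if "open A" for A
    using finite_pt_embedding(2) that by (simp add: open_map_def)
  have inv_c: "?c (diag_flow t w) = ?c w" for t w
    by (simp add: diag_flow_def split_beta)
  have finite_inv: "?\<Phi> t q \<in> finite_pt ` {w. P (?c w)}" if "q \<in> finite_pt ` {w. P (?c w)}" for P t q
    using that inv_c by (auto simp: torus_flow_finite_pt intro!: imageI)
  have slope_inv: "?\<Phi> t q \<in> slope_pt ` {w. P (snd w)}" if "q \<in> slope_pt ` {w. P (snd w)}" for P t q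
    using that flow_chart_flow[OF diag.flow_chart_slope] by (auto simp: strip_flow_def intro!: imageI)
  have slope_inv': "?\<Phi> t q \<in> slope_pt' ` {w. P (snd w)}" if "q \<in> slope_pt' ` {w. P (snd w)}" for P t q
    using that flow_chart_flow[OF diag.flow_chart_slope'] by (auto simp: strip_flow_def intro!: imageI)
  define M where "M = \<bar>?c z\<bar> + 1"
  have M: "M > 0" "\<bar>?c z\<bar> < M"
    by (auto simp: M_def)
  have opM: "open {w. \<bar>?c w\<bar> < M}" "open {w :: real \<times> real. \<bar>snd w\<bar> < 1 / M}"
    by (intro open_Collect_less continuous_intros)+
  have disj: False if "\<bar>?c w\<bar> < M" "\<bar>k\<bar> < 1 / M" "k \<noteq> 0" "\<bar>?c w\<bar> = 1 / \<bar>k\<bar>" for w k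
    using that M by (simp add: field_simps)
  obtain a b where q: "W = pt a b" using W pt_cases by blast
  consider x y where "a = Some x" "b = Some y" | x where "a = Some x" "b = None" | y where "a = None" "b = Some y"
    using W q by (cases a; cases b) auto
  then show ?thesis
  proof cases
    case 1
    then have Wz: "W = finite_pt (x, y)" by (simp add: q finite_pt_def)
    then have ne: "x - y \<noteq> ?c z"
      using orb unfolding diag.orbit_finite orbit_diag_flow by force
    define m where "m = (?c z + (x - y)) / 2"
    have op: "open {w. ?c w < m}" "open {w. ?c w > m}"
      by (intro open_Collect_less continuous_intros)+
    have dis: "finite_pt ` {w. ?c w < m} \<inter> finite_pt ` {w. ?c w > m} = {}"
      by (auto simp: finite_pt_eq_iff)
    show ?thesis
    proof (cases "?c z < x - y")
      case True
      then have "finite_pt z \<in> finite_pt ` {w. ?c w < m}" "W \<in> finite_pt ` {w. ?c w > m}"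
        unfolding Wz m_def by (auto intro!: imageI)
      then show ?thesis
        using dis finite_inv[of _ "\<lambda>c. c < m"] finite_inv[of _ "\<lambda>c. c > m"] op finite_open by (intro sep) auto
    next
      case False
      then have "finite_pt z \<in> finite_pt ` {w. ?c w > m}" "W \<in> finite_pt ` {w. ?c w < m}"
        using ne unfolding Wz m_def by (auto intro!: imageI)
      then show ?thesis
        using dis finite_inv[of _ "\<lambda>c. c < m"] finite_inv[of _ "\<lambda>c. c > m"] op finite_open
        by (intro sep) (auto simp: Int_commute)
    qed
  next
    case 2
    show ?thesis
    proof (rule sep[of "finite_pt ` {w. \<bar>?c w\<bar> < M}" "slope_pt ` {w. \<bar>snd w\<bar> < 1 / M}"])
      show "openin torus (finite_pt ` {w. \<bar>?c w\<bar> < M})" "openin torus (slope_pt ` {w. \<bar>snd w\<bar> < 1 / M})"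
        using finite_open opM slope_pt_embedding(2) by (auto simp: open_map_def)
      show "finite_pt z \<in> finite_pt ` {w. \<bar>?c w\<bar> < M}"
        using M by auto
      have "W = slope_pt (x, 0)" using 2 by (simp add: q slope_pt_def)
      then show "W \<in> slope_pt ` {w. \<bar>snd w\<bar> < 1 / M}"
        using M(1) by auto
      show "finite_pt ` {w. \<bar>?c w\<bar> < M} \<inter> slope_pt ` {w. \<bar>snd w\<bar> < 1 / M} = {}"
      proof (rule ccontr)
        assume "finite_pt ` {w. \<bar>?c w\<bar> < M} \<inter> slope_pt ` {w. \<bar>snd w\<bar> < 1 / M} \<noteq> {}"
        then obtain w v where wv: "finite_pt w = slope_pt v" "\<bar>?c w\<bar> < M" "\<bar>snd v\<bar> < 1 / M" by blast
        then have "snd v \<noteq> 0" by (auto simp: finite_pt_def slope_pt_def pt_eq_iff)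
        moreover from this have "w = slope_chart v"
          using wv(1) by (simp add: slope_pt_slope_chart finite_pt_eq_iff)
        then have "\<bar>?c w\<bar> = 1 / \<bar>snd v\<bar>"
          by (simp add: slope_chart_def split_beta)
        ultimately show False
          using disj wv by blast
      qed
    qed (use finite_inv[of _ "\<lambda>c. \<bar>c\<bar> < M"] slope_inv[of _ "\<lambda>c. \<bar>c\<bar> < 1 / M"] in auto)
  next
    case 3
    show ?thesis
    proof (rule sep[of "finite_pt ` {w. \<bar>?c w\<bar> < M}" "slope_pt' ` {w. \<bar>snd w\<bar> < 1 / M}"])
      show "openin torus (finite_pt ` {w. \<bar>?c w\<bar> < M})" "openin torus (slope_pt' ` {w. \<bar>snd w\<bar> < 1 / M})"
        using finite_open opM slope_pt_embedding(5) by (auto simp: open_map_def)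
      show "finite_pt z \<in> finite_pt ` {w. \<bar>?c w\<bar> < M}"
        using M by auto
      have "W = slope_pt' (y, 0)" using 3 by (simp add: q slope_pt'_def)
      then show "W \<in> slope_pt' ` {w. \<bar>snd w\<bar> < 1 / M}"
        using M(1) by auto
      show "finite_pt ` {w. \<bar>?c w\<bar> < M} \<inter> slope_pt' ` {w. \<bar>snd w\<bar> < 1 / M} = {}"
      proof (rule ccontr)
        assume "finite_pt ` {w. \<bar>?c w\<bar> < M} \<inter> slope_pt' ` {w. \<bar>snd w\<bar> < 1 / M} \<noteq> {}"
        then obtain w v where wv: "finite_pt w = slope_pt' v" "\<bar>?c w\<bar> < M" "\<bar>snd v\<bar> < 1 / M" by blast
        then have "snd v \<noteq> 0" by (auto simp: finite_pt_def slope_pt'_def pt_eq_iff)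
        moreover from this have "w = swap (slope_chart v)"
          using wv(1) by (simp add: slope_pt_slope_chart finite_pt_eq_iff)
        then have "\<bar>?c w\<bar> = 1 / \<bar>snd v\<bar>"
          by (simp add: slope_chart_def swap_def split_beta)
        ultimately show False
          using disj wv by blast
      qed
    qed (use finite_inv[of _ "\<lambda>c. \<bar>c\<bar> < M"] slope_inv'[of _ "\<lambda>c. \<bar>c\<bar> < 1 / M"] in auto)
  qed
qed

text \<open>The lines c = 1, 0, -1 are three distinct orbits, and c = 0 is non-separated from either
  of the others. Their images must avoid the finite cell, where every orbit of the translation is
  separated from all other regular orbits. So three orbits would have to fit into the two circles at
  infinity.\<close>

lemma not_equivalent_torus:
  "\<not> topologically_equivalent torus (torus_flow reeb_flow) torus (torus_flow diag_flow)"
proof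
  let ?R = "torus_flow reeb_flow" and ?D = "torus_flow diag_flow"
  assume "topologically_equivalent torus ?R torus ?D"
  then obtain h where h: "homeomorphic_map torus torus h" "carries_orbits h ?R (topspace torus) ?D (topspace torus)"
    unfolding topologically_equivalent_def by blast
  define g where "g = (\<lambda>c. h (finite_pt (sc 0 c)))"
  have mem: "finite_pt w \<in> topspace torus - {pt None None}" for w
    by (auto simp: finite_pt_def pt_in_torus pt_eq_iff)
  have h_inj: "h q = h q' \<Longrightarrow> q = q'" if "q \<in> topspace torus" "q' \<in> topspace torus" for q q'
    using h(1) that by (auto simp: homeomorphic_map_def inj_on_def)
  have h_mem: "h q \<in> topspace torus" if "q \<in> topspace torus" for q
    using homeomorphic_imp_surjective_map[OF h(1)] that by blast
  \<comment> \<open>Were the image the fixed point, \<open>h\<close> would send a whole non-constant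
    orbit to one point.\<close>
  have g_mem: "g c \<in> topspace torus - {pt None None}" for c
  proof -
    obtain t where t: "?R t (finite_pt (sc 0 c)) \<noteq> finite_pt (sc 0 c)"
      using reeb.not_fixed[OF mem] by blast
    have "g c \<noteq> pt None None"
    proof
      assume "g c = pt None None"
      moreover obtain \<sigma> :: "real \<Rightarrow> real" where "\<forall>t. h (?R t (finite_pt (sc 0 c))) = ?D (\<sigma> t) (g c)"
        using carries_orbits_reparametrization[OF h(2), of "finite_pt (sc 0 c)"] mem unfolding g_def by blast
      ultimately have "h (?R t (finite_pt (sc 0 c))) = h (finite_pt (sc 0 c))"
        by (simp add: torus_flow_infinity g_def)
      then show False
        using t h_inj reeb.torus_flow_away[OF mem] mem by blast
    qed
    then show ?thesis
      using h_mem mem by (auto simp: g_def)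
  qed
  have orb: "g c' \<notin> orbit ?D (g c)"
    if c: "c \<noteq> c'" "c = 0 \<or> \<bar>c\<bar> \<ge> 1" for c c'
  proof
    assume "g c' \<in> orbit ?D (g c)"
    then have "finite_pt (sc 0 c') \<in> orbit ?R (finite_pt (sc 0 c))"
      unfolding g_def using mem reeb.torus_flow_away[OF mem] by (intro orbit_homeomorphic_map[OF h]) auto
    then have "sc 0 c' \<in> orbit reeb_flow (sc 0 c)"
      unfolding reeb.orbit_finite inj_image_mem_iff[OF finite_pt_embedding(3)] .
    moreover have "orbit reeb_flow (sc 0 c) = {w. fst w - snd w = c}"
      using orbit_reeb_flow[of "sc 0 c"] c(2) by (auto simp: fst_sc snd_sc)
    ultimately show False
      using c(1) by (simp add: diff_sc)
  qed
  have pr: "prolongs torus ?D (g \<epsilon>) (g 0)" if "\<bar>\<epsilon>\<bar> = 1" for \<epsilon>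
  proof -
    have "prolongs torus ?R (finite_pt (sc 0 \<epsilon>)) (finite_pt (sc 0 0))"
      using prolongs_reeb_flow[OF that]
      by (rule prolongs_continuous_map[OF finite_pt_embedding(1), rotated 3]) (auto simp: torus_flow_finite_pt)
    then show ?thesis
      unfolding g_def using mem by (intro prolongs_homeomorphic_map[OF h]) auto
  qed
  have infinite: "g \<epsilon> \<notin> range finite_pt \<and> g 0 \<notin> range finite_pt" if "\<bar>\<epsilon>\<bar> = 1" for \<epsilon>
  proof (intro conjI notI)
    have "\<epsilon> \<noteq> 0" "\<bar>\<epsilon>\<bar> \<ge> 1" using that by auto
    then have o: "g 0 \<notin> orbit ?D (g \<epsilon>)" "g \<epsilon> \<notin> orbit ?D (g 0)"
      using orb[of \<epsilon> 0] orb[of 0 \<epsilon>] by auto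
    show False if "g \<epsilon> \<in> range finite_pt"
      using that separated_diag_flow[OF g_mem[of 0]] o(1) pr[OF \<open>\<bar>\<epsilon>\<bar> = 1\<close>] by auto
    show False if "g 0 \<in> range finite_pt"
      using that separated_diag_flow[OF g_mem[of \<epsilon>]] o(2) pr[OF \<open>\<bar>\<epsilon>\<bar> = 1\<close>] by auto
  qed
  define A where "A = range (\<lambda>x. pt (Some x) None)"
  define B where "B = range (\<lambda>x. pt None (Some x))"
  have AB: "q \<in> A \<or> q \<in> B" if q: "q \<in> topspace torus - {pt None None}" "q \<notin> range finite_pt" for q
  proof -
    obtain a b where "q = pt a b" using q pt_cases by blast
    then show ?thesis
      using q unfolding range_finite_pt A_def B_def by (cases a; cases b) auto
  qed
  have same: "q' \<in> orbit ?D q" if "q \<in> A \<and> q' \<in> A \<or> q \<in> B \<and> q' \<in> B" for q q'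
    using that diag.orbit_infinite unfolding A_def B_def by auto
  have "g 1 \<in> A \<or> g 1 \<in> B" "g 0 \<in> A \<or> g 0 \<in> B" "g (- 1) \<in> A \<or> g (- 1) \<in> B"
    using AB[OF g_mem] infinite[of 1] infinite[of "- 1"] by auto
  moreover have "g 0 \<notin> orbit ?D (g 1)" "g (- 1) \<notin> orbit ?D (g 1)" "g (- 1) \<notin> orbit ?D (g 0)"
    by (intro orb; simp)+
  ultimately show False
    using same by blast
qed

section \<open>Points of the diagonal\<close>

text \<open>For the translation the whole finite cell is a strip, and on the torus it has two
  boundary orbits, the circles at infinity. For the reversing flow this cell contains non-separated
  orbits; there the band |c| < 1 is used, with edges c = 1 and c = -1.\<close>

lemma ordinary_diagonal:
  assumes "fst z = snd z"
  shows "ordinary torus (torus_flow diag_flow) (finite_pt z)" "ordinary torus (torus_flow reeb_flow) (finite_pt z)"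
proof -
  have mem: "finite_pt w \<in> topspace torus - {pt None None}" "pt None (Some x) \<in> topspace torus - {pt None None}"
    "pt (Some x) None \<in> topspace torus - {pt None None}" for w x
    by (auto simp: finite_pt_def pt_in_torus pt_eq_iff)
  have p: "pt None None \<notin> range finite_pt"
    by (auto simp: range_finite_pt pt_eq_iff)
  let ?D = "torus_flow diag_flow" and ?R = "torus_flow reeb_flow"
  show "ordinary torus ?D (finite_pt z)"
  proof -
    have "flow_chart plane diag_flow (\<lambda>(x, c). (x, x - c))"
    proof (rule flow_chart_plane)
      show "continuous_on UNIV (\<lambda>(x :: real, c). (x, x - c))"
        unfolding split_beta by (intro continuous_intros)
    qed (auto simp: inj_def diag_flow_def strip_flow_def)
    then have e: "flow_chart torus ?D (finite_pt \<circ> (\<lambda>(x, c). (x, x - c)))"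
      by (rule diag.flow_chart_finite)
    have "range (\<lambda>(x :: real, c). (x, x - c)) = UNIV"
      by (rule surjI[of _ "\<lambda>(x, y). (x, x - y)"]) auto
    then have range: "range (finite_pt \<circ> (\<lambda>(x, c). (x, x - c))) = range finite_pt"
      by (metis image_comp)
    show ?thesis
    proof (rule diag.ordinary_torus[OF e, where a = "pt (Some 0) None" and b = "pt None (Some 0)"])
      show "orbit ?D (pt (Some 0) None) \<noteq> orbit ?D (pt None (Some 0))"
      proof -
        have "pt (Some 0) None \<notin> range (\<lambda>x. pt None (Some x))"
          by (auto simp: pt_eq_iff)
        then show ?thesis
          unfolding diag.orbit_infinite by auto
      qed
      have sub: "finite_pt ` {z. fst z - snd z \<noteq> 0} \<subseteq> range finite_pt" by blast
      show "torus frontier_of range (finite_pt \<circ> (\<lambda>(x, c). (x, x - c))) =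
          {pt None None} \<union> orbit ?D (pt (Some 0) None) \<union> orbit ?D (pt None (Some 0))"
        unfolding range
      proof (rule frontier_of_eqI)
        show "openin torus (range finite_pt)"
          using flow_chart_open[OF e open_UNIV] range by simp
        show "range finite_pt \<inter> ({pt None None} \<union> orbit ?D (pt (Some 0) None) \<union> orbit ?D (pt None (Some 0))) = {}"
          unfolding range_finite_pt diag.orbit_infinite by (auto simp: pt_eq_iff)
        have "pt a b \<in> range finite_pt \<union> ({pt None None} \<union> orbit ?D (pt (Some 0) None) \<union> orbit ?D (pt None (Some 0)))" for a b
          unfolding range_finite_pt diag.orbit_infinite by (cases a; cases b) auto
        then have "topspace torus - (range finite_pt \<union> ({pt None None} \<union> orbit ?D (pt (Some 0) None) \<union> orbit ?D (pt None (Some 0)))) = {}"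
          by (metis (no_types, lifting) Diff_eq_empty_iff pt_cases subsetI)
        then show "openin torus (topspace torus - (range finite_pt \<union> ({pt None None} \<union> orbit ?D (pt (Some 0) None) \<union> orbit ?D (pt None (Some 0)))))"
          by (metis openin_empty)
        show "{pt None None} \<union> orbit ?D (pt (Some 0) None) \<union> orbit ?D (pt None (Some 0)) \<subseteq> torus closure_of range finite_pt"
          using diag.infinity_in_closure[OF e] p infinite_orbits_in_closure closure_of_mono[OF sub]
          unfolding range diag.orbit_infinite by blast
      qed
    qed (use range mem p in auto)
  qed
  have e: "flow_chart torus ?R (finite_pt \<circ> core_chart)"
    using flow_chart_core by (rule reeb.flow_chart_finite)
  have range: "range (finite_pt \<circ> core_chart) = finite_pt ` {z. - 1 < fst z - snd z \<and> fst z - snd z < 1}"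
  proof -
    have "range core_chart = {z. - 1 < fst z - snd z \<and> fst z - snd z < 1}"
      unfolding range_core_chart by auto
    then show ?thesis
      by (metis image_comp)
  qed
  have orb: "orbit ?R (finite_pt (sc 0 \<epsilon>)) = finite_pt ` {z. fst z - snd z = \<epsilon>}" if "\<bar>\<epsilon>\<bar> = 1" for \<epsilon>
    unfolding reeb.orbit_finite using orbit_reeb_flow[of "sc 0 \<epsilon>"] that by (simp add: diff_sc)
  show "ordinary torus ?R (finite_pt z)"
  proof (rule reeb.ordinary_torus[OF e, where a = "finite_pt (sc 0 1)" and b = "finite_pt (sc 0 (- 1))"])
    show "finite_pt z \<in> range (finite_pt \<circ> core_chart)"
      unfolding range using assms by auto
    show "pt None None \<notin> range (finite_pt \<circ> core_chart)"
      using p by auto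
    have "finite_pt (sc 0 1) \<notin> finite_pt ` {z. fst z - snd z = - 1}"
      by (auto simp: finite_pt_eq_iff sc_def)
    moreover have "finite_pt (sc 0 1) \<in> finite_pt ` {z. fst z - snd z = 1}"
      by (auto simp: sc_def)
    ultimately show "orbit ?R (finite_pt (sc 0 1)) \<noteq> orbit ?R (finite_pt (sc 0 (- 1)))"
      by (auto simp: orb)
    let ?B = "{pt None None} \<union> orbit ?R (finite_pt (sc 0 1)) \<union> orbit ?R (finite_pt (sc 0 (- 1)))"
    show "torus frontier_of range (finite_pt \<circ> core_chart) = ?B"
    proof (rule frontier_of_eqI)
      show "openin torus (range (finite_pt \<circ> core_chart))"
        using flow_chart_open[OF e open_UNIV] .
      show "range (finite_pt \<circ> core_chart) \<inter> ?B = {}"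
        unfolding range using p by (auto simp: orb finite_pt_eq_iff)
      \<comment> \<open>The exterior of the band is |c| > 1 together with both circles at infinity.
        In the slope cells this is |k| < 1, which shows that it is open.\<close>
      have near: "slope_pt ` {w. \<bar>snd w\<bar> < 1} = {pt (Some x) b |x b. \<forall>y. b = Some y \<longrightarrow> \<bar>x - y\<bar> > 1}"
        "slope_pt' ` {w. \<bar>snd w\<bar> < 1} = {pt a (Some y) |a y. \<forall>x. a = Some x \<longrightarrow> \<bar>x - y\<bar> > 1}"
      proof -
        have k: "\<bar>1 / k\<bar> > 1" if "k \<noteq> 0" "\<bar>k\<bar> < 1" for k :: real
          using that by simp
        have k': "\<bar>1 / k\<bar> < 1" if "\<bar>k\<bar> > 1" for k :: real
          using that by simp
        show "slope_pt ` {w. \<bar>snd w\<bar> < 1} = {pt (Some x) b |x b. \<forall>y. b = Some y \<longrightarrow> \<bar>x - y\<bar> > 1}"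
        proof (intro set_eqI iffI)
          fix q assume "q \<in> {pt (Some x) b |x b. \<forall>y. b = Some y \<longrightarrow> \<bar>x - y\<bar> > 1}"
          then obtain x b where q: "q = pt (Some x) b" "\<forall>y. b = Some y \<longrightarrow> \<bar>x - y\<bar> > 1" by blast
          have "q = slope_pt (x, case b of None \<Rightarrow> 0 | Some y \<Rightarrow> 1 / (x - y))"
            using q by (auto simp: slope_pt_def split: option.splits)
          moreover have "\<bar>case b of None \<Rightarrow> 0 | Some y \<Rightarrow> 1 / (x - y)\<bar> < 1"
            using q(2) k' by (auto split: option.splits)
          ultimately show "q \<in> slope_pt ` {w. \<bar>snd w\<bar> < 1}"
            by auto
        qed (use k in \<open>auto simp: slope_pt_def pt_eq_iff\<close>)
        show "slope_pt' ` {w. \<bar>snd w\<bar> < 1} = {pt a (Some y) |a y. \<forall>x. a = Some x \<longrightarrow> \<bar>x - y\<bar> > 1}"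
        proof (intro set_eqI iffI)
          fix q assume "q \<in> {pt a (Some y) |a y. \<forall>x. a = Some x \<longrightarrow> \<bar>x - y\<bar> > 1}"
          then obtain a y where q: "q = pt a (Some y)" "\<forall>x. a = Some x \<longrightarrow> \<bar>x - y\<bar> > 1" by blast
          have "q = slope_pt' (y, case a of None \<Rightarrow> 0 | Some x \<Rightarrow> 1 / (y - x))"
            using q by (auto simp: slope_pt'_def split: option.splits)
          moreover have "\<bar>case a of None \<Rightarrow> 0 | Some x \<Rightarrow> 1 / (y - x)\<bar> < 1"
            using q(2) k' by (auto simp: abs_minus_commute split: option.splits)
          ultimately show "q \<in> slope_pt' ` {w. \<bar>snd w\<bar> < 1}"
            by auto
        qed (use k in \<open>auto simp: slope_pt'_def pt_eq_iff\<close>)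
      qed
      have "topspace torus - (range (finite_pt \<circ> core_chart) \<union> ?B) =
          slope_pt ` {w. \<bar>snd w\<bar> < 1} \<union> slope_pt' ` {w. \<bar>snd w\<bar> < 1}"
      proof (intro set_eqI)
        fix q
        show "q \<in> topspace torus - (range (finite_pt \<circ> core_chart) \<union> ?B) \<longleftrightarrow>
          q \<in> slope_pt ` {w. \<bar>snd w\<bar> < 1} \<union> slope_pt' ` {w. \<bar>snd w\<bar> < 1}"
        proof (cases "q \<in> topspace torus")
          case True
          then obtain a b where q: "q = pt a b" by (rule pt_cases)
          have fin: "pt a b \<in> finite_pt ` {w. P w} \<longleftrightarrow> (\<exists>x y. a = Some x \<and> b = Some y \<and> P (x, y))" for P
            by (force simp: finite_pt_def pt_eq_iff)
          have "q \<in> range (finite_pt \<circ> core_chart) \<union> ?B \<longleftrightarrow>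
              a = None \<and> b = None \<or> (\<exists>x y. a = Some x \<and> b = Some y \<and> \<bar>x - y\<bar> \<le> 1)"
            unfolding range q by (auto simp: orb fin pt_eq_iff)
          moreover have "q \<in> slope_pt ` {w. \<bar>snd w\<bar> < 1} \<union> slope_pt' ` {w. \<bar>snd w\<bar> < 1} \<longleftrightarrow>
              \<not> (a = None \<and> b = None \<or> (\<exists>x y. a = Some x \<and> b = Some y \<and> \<bar>x - y\<bar> \<le> 1))"
            unfolding near q by (cases a; cases b) (auto simp: pt_eq_iff)
          ultimately show ?thesis
            using True by blast
        next
          case False
          then show ?thesis
            unfolding near using pt_in_torus by auto
        qed
      qed
      moreover have "openin torus (slope_pt ` {w. \<bar>snd w\<bar> < 1} \<union> slope_pt' ` {w. \<bar>snd w\<bar> < 1})"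
      proof -
        have "open {w :: real \<times> real. \<bar>snd w\<bar> < 1}"
          by (intro open_Collect_less continuous_intros)
        then show ?thesis
          using slope_pt_embedding(2,5) by (auto simp: open_map_def)
      qed
      ultimately show "openin torus (topspace torus - (range (finite_pt \<circ> core_chart) \<union> ?B))"
        by simp
      have "pt None None \<in> torus closure_of range (finite_pt \<circ> core_chart)"
        using p by (intro reeb.infinity_in_closure[OF e]) auto
      moreover have "orbit ?R (finite_pt (sc 0 \<epsilon>)) \<subseteq> torus closure_of range (finite_pt \<circ> core_chart)"
        if "\<bar>\<epsilon>\<bar> = 1" for \<epsilon>
      proof -
        have "\<epsilon> = - 1 \<or> \<epsilon> = 1"
          using that by linarith
        then show ?thesis
          unfolding orb[OF that] range using finite_in_closure_of_band[of "- 1" 1] by auto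
      qed
      ultimately show "?B \<subseteq> torus closure_of range (finite_pt \<circ> core_chart)"
        by simp
    qed
  qed (use mem in auto)
qed

text \<open>Three connected cells cover the punctured torus, and all of them contain
  \<open>finite_pt (1, 0)\<close>.\<close>

lemma connected_punctured_torus: "connectedin torus (topspace torus - {pt None None})"
proof -
  have conn: "connectedin torus (range e)" if "continuous_map plane torus e" for e
    using connectedin_continuous_map_image[OF that, of UNIV] connected_UNIV by simp
  have z: "(1, 0) \<in> {z :: real \<times> real. fst z - snd z \<noteq> 0}"
    by simp
  have "finite_pt (1, 0) \<in> range slope_pt" "finite_pt (1, 0) \<in> range slope_pt'"
    using off_diagonal_subset imageI[OF z, of finite_pt] by blast+
  then have "connectedin torus (range finite_pt \<union> range slope_pt \<union> range slope_pt')"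
    by (intro connectedin_Un conn finite_pt_embedding slope_pt_embedding) blast+
  moreover have "range finite_pt \<union> range slope_pt \<union> range slope_pt' = topspace torus - {pt None None}"
  proof (intro set_eqI)
    fix q
    show "q \<in> range finite_pt \<union> range slope_pt \<union> range slope_pt' \<longleftrightarrow> q \<in> topspace torus - {pt None None}"
    proof (cases "q \<in> topspace torus")
      case True
      then obtain a b where "q = pt a b" by (rule pt_cases)
      then show ?thesis
        unfolding range_finite_pt range_slope_pt range_slope_pt' by (cases a; cases b) (auto simp: pt_eq_iff pt_in_torus)
    next
      case False
      then show ?thesis
        unfolding range_finite_pt range_slope_pt range_slope_pt' using pt_in_torus by blast
    qed
  qed
  ultimately show ?thesis by simp
qed

lemma configurations_torus: "have_equivalent_configurations torus (torus_flow reeb_flow) (torus_flow diag_flow)"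
proof (rule have_equivalent_configurations_of_common_orbit[where Z = "{pt None None}" and r = "finite_pt (sc 0 1)"])
  show "separatrix_set torus (torus_flow reeb_flow) = {pt None None}"
    "separatrix_set torus (torus_flow diag_flow) = {pt None None}"
    by (intro reeb.separatrix_set_torus diag.separatrix_set_torus ordinary_diagonal; simp)+
  show "connectedin torus (topspace torus - {pt None None})"
    by (rule connected_punctured_torus)
  show "finite_pt (sc 0 1) \<in> topspace torus - {pt None None}"
    by (auto simp: finite_pt_def pt_in_torus pt_eq_iff)
  show "torus_flow reeb_flow t q = torus_flow diag_flow t q"
    if "q \<in> {pt None None} \<union> orbit (torus_flow reeb_flow) (finite_pt (sc 0 1))" for q t
  proof -
    have "orbit reeb_flow (sc 0 1) = {w. fst w - snd w = 1}"
      using orbit_reeb_flow[of "sc 0 1"] by (simp add: diff_sc)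
    then have "q = pt None None \<or> (\<exists>z. q = finite_pt z \<and> fst z - snd z = 1)"
      using that unfolding reeb.orbit_finite by auto
    then show ?thesis
      using reeb_flow_outer by (auto simp: torus_flow_infinity torus_flow_finite_pt)
  qed
  show "torus_flow reeb_flow 0 (finite_pt (sc 0 1)) = finite_pt (sc 0 1)"
    by (simp add: torus_flow_finite_pt reeb_flow_sc damping_outer)
qed

theorem mainTheorem2:
  shows "(\<exists>\<Phi>\<^sub>1 \<Phi>\<^sub>2. is_flow plane \<Phi>\<^sub>1 \<and> is_flow plane \<Phi>\<^sub>2 \<and>
            discrete_set plane (singular_points plane \<Phi>\<^sub>1) \<and>
            discrete_set plane (singular_points plane \<Phi>\<^sub>2) \<and>
            have_equivalent_configurations plane \<Phi>\<^sub>1 \<Phi>\<^sub>2 \<and>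
            \<not> topologically_equivalent plane \<Phi>\<^sub>1 plane \<Phi>\<^sub>2)
       \<and> (\<exists>\<Phi>\<^sub>1 \<Phi>\<^sub>2. is_flow torus \<Phi>\<^sub>1 \<and> is_flow torus \<Phi>\<^sub>2 \<and>
            discrete_set torus (singular_points torus \<Phi>\<^sub>1) \<and>
            discrete_set torus (singular_points torus \<Phi>\<^sub>2) \<and>
            have_equivalent_configurations torus \<Phi>\<^sub>1 \<Phi>\<^sub>2 \<and>
            \<not> topologically_equivalent torus \<Phi>\<^sub>1 torus \<Phi>\<^sub>2)"
proof (intro conjI exI)
  show "is_flow plane reeb_flow" "is_flow plane diag_flow"
    by (rule is_flow_reeb_flow is_flow_diag_flow)+
  show "discrete_set plane (singular_points plane reeb_flow)" "discrete_set plane (singular_points plane diag_flow)"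
    using singular_points_plane escapes_reeb_flow escapes_diag_flow by (simp_all add: discrete_set_def)
  show "have_equivalent_configurations plane reeb_flow diag_flow"
    by (rule configurations_plane)
  show "\<not> topologically_equivalent plane reeb_flow plane diag_flow"
    by (rule not_equivalent_plane)
  have "discrete_set torus {pt None None}"
    unfolding discrete_set_def using pt_in_torus by (auto intro: exI[of _ "topspace torus"])
  then show "discrete_set torus (singular_points torus (torus_flow reeb_flow))"
    "discrete_set torus (singular_points torus (torus_flow diag_flow))"
    by (simp_all add: reeb.singular_points_torus diag.singular_points_torus)
  show "is_flow torus (torus_flow reeb_flow)" "is_flow torus (torus_flow diag_flow)"
    by (rule reeb.is_flow_torus diag.is_flow_torus)+
  show "have_equivalent_configurations torus (torus_flow reeb_flow) (torus_flow diag_flow)"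
    by (rule configurations_torus)
  show "\<not> topologically_equivalent torus (torus_flow reeb_flow) torus (torus_flow diag_flow)"
    by (rule not_equivalent_torus)
qed

end
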